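(* Let $m\ge 1$, $n=2m$, let $p$ be an odd prime and $q=p^n$. Let $t$ be a positive integer with $t\equiv 2\pmod 4$ and $t\not\equiv 0\pmod{p^m+1}$. Set $s_1=\frac{t+2}{4}$, $s_2=\frac{3t+2}{4}$, $d_1=s_1(p^m-1)+1$, $d_2=s_2(p^m-1)+1$ and $l=\gcd(t,p^m+1)$. Then $\mathcal{C}_{q,d_1,d_2}^{\perp}$ is a $p$-ary linear code with parameters $[p^n-1,\,4m,\,(p^m-p^{m-1})(p^m+1-\frac{3l}{2})]$, and its weight distribution is as follows: \begin{itemize} \item weight $0$: $1$ codeword; \item weight $(p^m-p^{m-1})(p^m+1-\frac{3l}{2})$: $\frac{2(p^{2m}-1)(l-p^m-1)(l-2p^m-2)}{3l^3}$ codewords; \item weight $(p^m-p^{m-1})(p^m+1-l)$: $\frac{(p^{2m}-1)(2p^m+2-(p^m+3)l)(l-2p^m-2)}{l^3}$ codewords; \item weight $(p^m-p^{m-1})(p^m+1-\frac{l}{2})$: $\frac{2(p^{2m}-1)\left((p^{2m}+2p^m+3)l^2-(2p^{2m}+7p^m+5)l+2(p^m+1)^2\right)}{l^3}$ codewords; \item weight $(p^m-p^{m-1})(p^m+1)$: $\frac{(p^{2m}-1)\left(3(p^{2m}+1)l^3-(6p^{2m}+9p^m+11)l^2+6(p^{2m}+3p^m+2)l-4(p^m+1)^2\right)}{3l^3}$ codewords. \end{itemize}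
   Context: Let $\theta$ be a fixed primitive element of $\mathbb{F}_q$. For a positive integer $i$, $g_i(x)$ denotes the minimal polynomial of $\theta^i$ over $\mathbb{F}_p$. $\mathcal{C}_{q,d_1,d_2}$ is the cyclic code of length $q-1$ over $\mathbb{F}_p$ with generator polynomial $g_{d_1}(x)g_{d_2}(x)$, i.e. the ideal of $\mathbb{F}_p[x]/(x^{q-1}-1)$ generated by $g_{d_1}(x)g_{d_2}(x)$, where a word $(c_0,\dots,c_{q-2})$ is identified with $\sum_i c_i x^i$. $\mathcal{C}_{q,d_1,d_2}^{\perp}$ is its dual code with respect to the standard inner product. An $[N,k,d]$ code is a linear code of length $N$, dimension $k$ and minimum Hamming distance $d$. The weight distribution lists, for each Hamming weight that occurs, the number of codewords of that weight. *)

theory Defs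
  imports
    "Berlekamp_Zassenhaus.Finite_Field"
    "Jordan_Normal_Form.VS_Connect"
    "HOL-Number_Theory.Cong"
begin

section \<open>Minimal polynomials over the prime field\<close>

text \<open>
  The field with \<open>p\<close> elements is \<open>'p mod_ring\<close> with \<open>p = CARD('p)\<close>. If \<open>'q\<close> is a field of
  characteristic \<open>p\<close>, the following map is the unique field embedding of the prime field
  into \<open>'q\<close> (see \<open>field_hom_prime_embed\<close> below).
\<close>

definition prime_embed :: "'p::prime_card mod_ring \<Rightarrow> 'q::field" where
  "prime_embed a = of_int (to_int_mod_ring a)"

definition is_min_poly :: "'q::field \<Rightarrow> 'p::prime_card mod_ring poly \<Rightarrow> bool" where
  "is_min_poly x g \<longleftrightarrow>
     lead_coeff g = 1 \<and> poly (map_poly prime_embed g) x = 0 \<and>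
     (\<forall>h :: 'p mod_ring poly. h \<noteq> 0 \<and> poly (map_poly prime_embed h) x = 0 \<longrightarrow> degree g \<le> degree h)"

definition min_poly :: "'q::field \<Rightarrow> 'p::prime_card mod_ring poly" where
  "min_poly x = (THE g. is_min_poly x g)"

text \<open>
  If \<open>CARD('q)\<close> is a power of \<open>CARD('p)\<close>, then \<open>prime_embed\<close> is a homomorphism and
  \<open>min_poly\<close> is well defined.
\<close>

lemma CHAR_eq_CARD:
  assumes "CARD('q::finite_field) = CARD('p::prime_card) ^ n"
  shows "CHAR('q) = CARD('p)"
proof -
  have pr: "prime CHAR('q)"
    by (rule prime_CHAR_semidom) simp
  have "CHAR('q) dvd CARD('q)"
    by (rule CHAR_dvd_CARD)
  then have "CHAR('q) dvd CARD('p)"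
    unfolding assms using pr prime_dvd_power by blast
  then show ?thesis
    using pr prime_card[where 'a='p] primes_dvd_imp_eq by blast
qed

lemma field_hom_prime_embed:
  assumes "CHAR('q::field) = CARD('p::prime_card)"
  shows "field_hom (prime_embed :: 'p mod_ring \<Rightarrow> 'q)"
proof -
  have red: "(of_int (z mod int CARD('p)) :: 'q) = of_int z" for z
    unfolding of_int_eq_iff_cong_CHAR assms by (simp add: cong_def)
  have "to_int_mod_ring (a + b) = (to_int_mod_ring a + to_int_mod_ring b) mod int CARD('p)"
    for a b :: "'p mod_ring"
    by transfer simp
  moreover have "to_int_mod_ring (a * b) = (to_int_mod_ring a * to_int_mod_ring b) mod int CARD('p)"
    for a b :: "'p mod_ring"
    by transfer simp
  ultimately show ?thesis
    by unfold_locales (simp_all add: prime_embed_def red)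
qed

lemma ex1_min_poly:
  fixes x :: "'q::finite_field"
  assumes "CARD('q) = CARD('p::prime_card) ^ n"
  shows "\<exists>!g :: 'p mod_ring poly. is_min_poly x g"
proof -
  interpret field_hom "prime_embed :: 'p mod_ring \<Rightarrow> 'q"
    by (rule field_hom_prime_embed[OF CHAR_eq_CARD[OF assms]])
  interpret E: map_poly_comm_ring_hom "prime_embed :: 'p mod_ring \<Rightarrow> 'q" ..
  let ?E = "map_poly (prime_embed :: 'p mod_ring \<Rightarrow> 'q)"
  let ?R = "\<lambda>h. h \<noteq> 0 \<and> poly (?E h) x = 0"
  have ev_diff: "poly (?E (g - h)) x = poly (?E g) x - poly (?E h) x" for g h
    by (simp only: E.hom_minus poly_diff)
  have ev_smult: "poly (?E (smult c h)) x = prime_embed c * poly (?E h) x" for c h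
    by (simp only: map_poly_hom_smult poly_smult)
  have ev_monom: "poly (?E (monom 1 i)) x = x ^ i" for i
    by (simp add: map_poly_monom Polynomial.poly_monom)
  have "\<exists>h. ?R h"
  proof -
    have "\<not> inj (\<lambda>i::nat. x ^ i)"
      using finite_imageD[of "\<lambda>i::nat. x ^ i" UNIV] by auto
    then obtain i j :: nat where ij: "x ^ i = x ^ j" "i \<noteq> j"
      by (auto simp: inj_def)
    let ?h = "monom 1 i - monom 1 j :: 'p mod_ring poly"
    have "coeff ?h i \<noteq> 0"
      using ij by simp
    then have "?h \<noteq> 0"
      by force
    moreover have "poly (?E ?h) x = 0"
      using ij by (simp only: ev_diff ev_monom right_minus_eq)
    ultimately show ?thesis by blast
  qed
  then obtain h where h: "?R h" and least: "\<And>h'. ?R h' \<Longrightarrow> degree h \<le> degree h'"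
    using ex_has_least_nat[of ?R _ degree] by blast
  let ?g = "smult (inverse (lead_coeff h)) h"
  have "is_min_poly x ?g"
    using h least by (simp add: is_min_poly_def ev_smult)
  moreover have "g = g'" if "is_min_poly x g" "is_min_poly x g'" for g g' :: "'p mod_ring poly"
  proof (rule ccontr)
    assume "g \<noteq> g'"
    have nz: "g \<noteq> 0" "g' \<noteq> 0"
      using that by (auto simp: is_min_poly_def)
    then have deg: "degree g = degree g'"
      using that by (meson is_min_poly_def order_antisym)
    have lc: "coeff (g - g') (degree g) = 0"
      using that deg by (simp add: is_min_poly_def)
    have "degree (g - g') \<noteq> degree g"
      using lc \<open>g \<noteq> g'\<close> by (metis leading_coeff_0_iff right_minus_eq)
    moreover have "degree (g - g') \<le> degree g"
      using degree_diff_le[of g "degree g" g'] deg by simp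
    moreover have "poly (?E (g - g')) x = 0"
      using that by (simp add: is_min_poly_def ev_diff)
    ultimately show False
      using that(1) \<open>g \<noteq> g'\<close> unfolding is_min_poly_def
      by (metis le_antisym right_minus_eq)
  qed
  ultimately show ?thesis by blast
qed

definition primitive_elem :: "'q::finite_field \<Rightarrow> bool" where
  "primitive_elem \<theta> \<longleftrightarrow> range (\<lambda>k::nat. \<theta> ^ k) = UNIV - {0}"


section \<open>Linear codes\<close>

definition word_poly :: "'a::comm_ring_1 vec \<Rightarrow> 'a poly" where
  "word_poly c = (\<Sum>i<dim_vec c. monom (c $ i) i)"

text \<open>
  The ideal of \<open>F[x]/(x\<^sup>N - 1)\<close> generated by the class of \<open>g\<close>, as a set of words of length \<open>N\<close>.
\<close>

definition cyclic_code :: "nat \<Rightarrow> 'a::field poly \<Rightarrow> 'a vec set" where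
  "cyclic_code N g = {c \<in> carrier_vec N. \<exists>a. [word_poly c = a * g] (mod (monom 1 N - 1))}"

abbreviation dual_code :: "nat \<Rightarrow> 'a::field vec set \<Rightarrow> 'a vec set" where
  "dual_code N C \<equiv> vec_module.orthogonal_complement N C"

definition hamming_weight :: "'a::zero vec \<Rightarrow> nat" where
  "hamming_weight c = card {i. i < dim_vec c \<and> c $ i \<noteq> 0}"

definition hamming_dist :: "'a vec \<Rightarrow> 'a vec \<Rightarrow> nat" where
  "hamming_dist u v = card {i. i < dim_vec u \<and> u $ i \<noteq> v $ i}"

definition has_min_dist :: "'a vec set \<Rightarrow> nat \<Rightarrow> bool" where
  "has_min_dist C d \<longleftrightarrow>
     (\<exists>u\<in>C. \<exists>v\<in>C. u \<noteq> v \<and> hamming_dist u v = d) \<and>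
     (\<forall>u\<in>C. \<forall>v\<in>C. u \<noteq> v \<longrightarrow> d \<le> hamming_dist u v)"

definition linear_code :: "nat \<Rightarrow> nat \<Rightarrow> nat \<Rightarrow> 'a::field vec set \<Rightarrow> bool" where
  "linear_code N k d C \<longleftrightarrow>
     subspace class_ring C (module_vec TYPE('a) N) \<and>
     vectorspace.dim class_ring ((module_vec TYPE('a) N)\<lparr>carrier := C\<rparr>) = k \<and>
     has_min_dist C d"

end

theory Submission
  imports
    Defs
    "Berlekamp_Zassenhaus.Berlekamp_Type_Based"
begin

text \<open>
  Let \<open>P = p\<^sup>m\<close> and write \<open>t = 2 (2 h + 1)\<close>. By Delsarte duality the codewords are
  \<open>c(a, b) = (Tr (a \<theta>\<^bsup>i d1\<^esup> + b \<theta>\<^bsup>i d2\<^esup>))\<^sub>i\<close>. Since \<open>d1\<close> and \<open>d2\<close> are \<open>1\<close> modulo \<open>P - 1\<close>,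
  the trace from \<open>F\<^bsub>q\<^esub>\<close> to \<open>F\<^bsub>P\<^esub>\<close> of the inner expression is \<open>F\<^bsub>P\<^esub>\<close>-homogeneous in \<open>x = \<theta>\<^sup>i\<close>, and for
  \<open>z = x\<^bsup>P - 1\<^esup>\<close> it vanishes iff \<open>w = z\<^bsup>2 h + 1\<^esup>\<close> is a root of the self-reciprocal cubic
  \<open>b w\<^sup>3 + a w\<^sup>2 + a\<^sup>P w + b\<^sup>P\<close>. Hence the weight of \<open>c(a, b)\<close> is \<open>(P - P/p) (P + 1 - g r)\<close>, where
  \<open>g = l / 2\<close> and \<open>r\<close> is the number of roots of the cubic in the group of \<open>M\<close>-th roots of unity,
  \<open>M = (P + 1) / g\<close>. For \<open>k \<le> 3\<close> distinct elements of norm \<open>1\<close>, exactly \<open>P\<^bsup>4 - k\<^esup>\<close> pairs \<open>(a, b)\<close>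
  give a cubic vanishing at all of them; this yields the first three binomial moments of \<open>r\<close>, which
  determine its distribution because \<open>r \<le> 3\<close> for a nonzero cubic.

  That the \<open>c(a, b)\<close> exhaust the dual code is a count: a word of the dual of a cyclic code is
  determined by its first \<open>k\<close> entries, where \<open>k\<close> is the degree of the generator polynomial, here at
  most \<open>4 m\<close>; so the dual has at most \<open>p\<^bsup>4 m\<^esup> = q\<^sup>2\<close> elements, the number of pairs \<open>(a, b)\<close>. In
  particular the two minimal polynomials need not be shown to be distinct.
\<close>

section \<open>Power maps of a finite field\<close>

text \<open>If one fibre had fewer than \<open>k\<close> points and all others at most
  \<open>k\<close>, the total would drop below \<open>k * card B\<close>. This turns upper bounds on
  numbers of roots into exact fibre sizes.\<close>

lemma card_fibre_eq:
  assumes fin: "finite A" "finite B" and img: "f ` A \<subseteq> B"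
    and le: "\<And>b. b \<in> B \<Longrightarrow> card {a \<in> A. f a = b} \<le> k"
    and card: "k * card B \<le> card A" and b: "b \<in> B"
  shows "card {a \<in> A. f a = b} = k"
proof (rule ccontr)
  assume "card {a \<in> A. f a = b} \<noteq> k"
  then have less: "card {a \<in> A. f a = b} < k"
    using le[OF b] by simp
  have "A = (\<Union>b\<in>B. {a \<in> A. f a = b})"
    using img by blast
  moreover have "card (\<Union>b\<in>B. {a \<in> A. f a = b}) = (\<Sum>b\<in>B. card {a \<in> A. f a = b})"
    by (rule card_UN_disjoint) (use fin in auto)
  ultimately have "card A = (\<Sum>b\<in>B. card {a \<in> A. f a = b})"
    by simp
  also have "\<dots> < (\<Sum>b\<in>B. k)"
    by (rule sum_strict_mono_ex1[OF fin(2)]) (use le less b in blast)+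
  finally show False
    using card by (simp add: mult.commute)
qed

text \<open>On the nonzero elements the fibres of \<open>x ^ k\<close> have at most \<open>k\<close>
  points, and the values lie among the at most \<open>r\<close> solutions of
  \<open>u ^ r = 1\<close>. As \<open>k * r\<close> is the number of nonzero elements, both bounds
  are tight.\<close>

lemma card_power_eq:
  fixes v :: "'a::finite_field"
  assumes kr: "k * r = CARD('a) - 1" and v: "v ^ r = 1"
  shows "card {x::'a. x ^ k = v} = k"
proof -
  have C: "CARD('a) > 1"
    using card_mono[of UNIV "{0,1::'a}"] by simp
  then have pos: "k > 0" "r > 0"
    using kr by (auto intro!: Nat.gr0I)
  have le: "card {x::'a. x ^ j = u} \<le> j" if "j > 0" for j u
  proof -
    have "{x::'a. x ^ j = u} = {x. poly (monom 1 j - [:u:]) x = 0}"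
      by (simp add: poly_monom)
    moreover have "coeff (monom 1 j - [:u:]) j = 1"
      using that by (simp add: coeff_pCons split: nat.split)
    then have "monom 1 j - [:u:] \<noteq> 0"
      by force
    moreover have "degree (monom 1 j - [:u:]) \<le> j"
      by (intro degree_diff_le) (simp_all add: degree_monom_le)
    ultimately show ?thesis
      using card_poly_roots_bound by (metis order_trans)
  qed
  have fermat: "x ^ (CARD('a) - 1) = 1" if "x \<noteq> 0" for x :: 'a
    using finite_field_power_card_eq_same[of x] that C by (simp add: power_eq_if)
  have nz: "x ^ (k * r) = 1 \<longleftrightarrow> x \<noteq> 0" for x :: 'a
    using fermat[of x] pos by (cases "x = 0") (simp add: zero_power, simp add: kr)
  have "card {x \<in> UNIV - {0::'a}. x ^ k = v} = k"
  proof (rule card_fibre_eq)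
    show "(\<lambda>x. x ^ k) ` (UNIV - {0::'a}) \<subseteq> {u. u ^ r = 1}"
      by (auto simp: nz simp flip: power_mult)
    show "card {x \<in> UNIV - {0::'a}. x ^ k = u} \<le> k" for u
      by (rule order_trans[OF card_mono le[OF pos(1), of u]]) auto
    have "card (UNIV - {0::'a}) = k * r"
      using kr by (simp add: card_Diff_singleton)
    then show "k * card {u::'a. u ^ r = 1} \<le> card (UNIV - {0::'a})"
      using le[OF pos(2), of 1] by simp
    show "v \<in> {u. u ^ r = 1}"
      using v by simp
  qed simp_all
  moreover have "{x \<in> UNIV - {0}. x ^ k = v} = {x. x ^ k = v}"
    using v pos by (auto simp: zero_power)
  ultimately show ?thesis
    by simp
qed

section \<open>Self-reciprocal cubics over a quadratic extension\<close>

text \<open>Here \<open>x ^ P\<close> is the conjugate of \<open>x\<close> over the subfield of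
  order \<open>P\<close>, and \<open>w ^ (P + 1) = 1\<close> says that \<open>w\<close> has norm 1,
  so that its conjugate is its inverse.\<close>

locale conjugation_field =
  fixes P :: nat and ty :: "'a::finite_field itself"
  assumes card: "CARD('a) = P\<^sup>2"
    and odd: "odd P"
    and add: "\<And>x y :: 'a. (x + y) ^ P = x ^ P + y ^ P"
begin

lemma P_gt_1: "P > 1"
proof -
  have "card {0, 1 :: 'a} \<le> P\<^sup>2"
    unfolding card[symmetric] by (rule card_mono) auto
  then show ?thesis
    by (cases "P = 0 \<or> P = 1") auto
qed

lemma conj_conj: "((x::'a) ^ P) ^ P = x"
  using finite_field_power_card_eq_same[of x] by (simp add: card power2_eq_square power_mult)

lemma minus: "(- x :: 'a) ^ P = - (x ^ P)"
  using odd by simp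

lemma diff: "(x - y :: 'a) ^ P = x ^ P - y ^ P"
  using add[of x "- y"] by (simp add: minus)

text \<open>Apart from 0 the solutions are those of \<open>c ^ (P - 1) = - w\<close>, and
  \<open>- w\<close> again has norm 1 because \<open>P + 1\<close> is even. The case
  \<open>w = -1\<close> counts the subfield of order \<open>P\<close>.\<close>

lemma card_twisted_fixed:
  assumes "w ^ (P + 1) = (1::'a)"
  shows "card {c. c ^ P = - (c * w)} = P"
proof -
  have "c ^ P = c * c ^ (P - 1)" for c :: 'a
    using P_gt_1 power_minus_mult[of P c] by (simp add: mult.commute)
  then have "c ^ P = - (c * w) \<longleftrightarrow> c = 0 \<or> c ^ (P - 1) = - w" for c
    by (metis mult_cancel_left mult_minus_right)
  then have "{c. c ^ P = - (c * w)} = insert 0 {c. c ^ (P - 1) = - w}"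
    by auto
  moreover have "0 \<notin> {c. c ^ (P - 1) = - w}"
    using P_gt_1 assms by (auto simp: power_0_left)
  moreover have "card {c. c ^ (P - 1) = - w} = P - 1"
  proof (rule card_power_eq)
    show "(P - 1) * (P + 1) = CARD('a) - 1"
      by (simp add: card power2_eq_square algebra_simps)
    show "(- w) ^ (P + 1) = 1"
      using assms odd by simp
  qed
  ultimately show ?thesis
    using P_gt_1 by simp
qed

text \<open>For \<open>w\<close> of norm 1 the conjugate of the value at \<open>w\<close> is that
  value divided by \<open>w ^ 3\<close>. This is why prescribing one root costs only a factor
  \<open>P\<close>, not \<open>P ^ 2\<close>, in the number of pairs.\<close>

definition selfrec :: "'a \<times> 'a \<Rightarrow> 'a \<Rightarrow> 'a" where
  "selfrec v w = (case v of (a, b) \<Rightarrow> b * w ^ 3 + a * w ^ 2 + a ^ P * w + b ^ P)"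

text \<open>Since \<open>w ^ P\<close> inverts \<open>w\<close>, the last two terms are
  \<open>w\<close> times the conjugate of \<open>c = a + b * w\<close>, while the first two are
  \<open>c * w ^ 2\<close>. The condition therefore involves the pair only through
  \<open>c\<close>.\<close>

lemma selfrec_root1:
  assumes "w ^ (P + 1) = 1"
  shows "selfrec (a, b) w = 0 \<longleftrightarrow> (a + b * w) ^ P = - ((a + b * w) * w)"
proof -
  \<comment> \<open>\<open>A\<close>, \<open>B\<close>, \<open>u\<close> stand for the conjugates of
    \<open>a\<close>, \<open>b\<close>, \<open>w\<close>, so this is a polynomial identity; its last
    term vanishes for norm 1.\<close>
  have "b * w ^ 3 + a * w ^ 2 + A * w + B = w * ((A + B * u) + (a + b * w) * w) + B * (1 - w * u)"
    for A B u
    by (simp add: algebra_simps power2_eq_square power3_eq_cube)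
  from this[of "a ^ P" "b ^ P" "w ^ P"]
  have "selfrec (a, b) w = w * ((a + b * w) ^ P + (a + b * w) * w)"
    using assms by (simp add: selfrec_def add power_mult_distrib)
  moreover have "w \<noteq> 0"
    using assms by auto
  ultimately show ?thesis
    by (simp add: eq_neg_iff_add_eq_0)
qed

text \<open>This is Vieta: the roots multiply to \<open>- (b ^ P) / b\<close>, so the third root is
  \<open>- (b ^ P) / (b * w1 * w2)\<close>, and \<open>r\<close> is the resulting formula for the
  coefficient of \<open>x ^ 2\<close>. The form with cleared denominators also covers
  \<open>b = 0\<close>.\<close>

lemma selfrec_factor:
  assumes w: "w1 ^ (P + 1) = 1" "w2 ^ (P + 1) = 1"
    and r: "a * (w1 * w2) = b ^ P - b * (w1 * w2) * (w1 + w2)"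
  shows "w1 * w2 * selfrec (a, b) x = (x - w1) * (x - w2) * (b ^ P + b * (w1 * w2 * x))"
proof -
  have alg: "w1 * w2 * (b * x ^ 3 + a * x ^ 2 + A * x + B)
      = (x - w1) * (x - w2) * (B + b * (w1 * w2 * x))"
    if "w1 * u1 = 1" "w2 * u2 = 1" "a * (w1 * w2) = B - b * (w1 * w2) * (w1 + w2)"
      "A * (u1 * u2) = b - B * (u1 * u2) * (u1 + u2)" for A B u1 u2
  proof -
    have "w1 * w2 * A = (w1 * w2) * (w1 * w2) * (A * (u1 * u2))"
      using that(1,2) by (metis mult.assoc mult.left_commute mult_1_right)
    also have "\<dots> = b * (w1 * w2)\<^sup>2 - B * ((w1 * u1) * (w2 * u2)) * ((w1 * u1) * w2 + (w2 * u2) * w1)"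
      unfolding that(4) by (simp add: algebra_simps power2_eq_square)
    finally have A: "w1 * w2 * A = b * (w1 * w2)\<^sup>2 - B * (w1 + w2)"
      using that(1,2) by (simp add: add.commute)
    have "w1 * w2 * (b * x ^ 3 + a * x ^ 2 + A * x + B)
        = b * (w1 * w2) * x ^ 3 + a * (w1 * w2) * x ^ 2 + w1 * w2 * A * x + w1 * w2 * B"
      by (simp add: algebra_simps)
    also have "\<dots> = (x - w1) * (x - w2) * (B + b * (w1 * w2 * x))"
      unfolding that(3) A by (simp add: algebra_simps power2_eq_square power3_eq_cube)
    finally show ?thesis .
  qed
  \<comment> \<open>The conjugate of \<open>r\<close> supplies the missing relation, that for the
    coefficient of \<open>x\<close>.\<close>
  have "(a * (w1 * w2)) ^ P = (b ^ P - b * (w1 * w2) * (w1 + w2)) ^ P"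
    using r by simp
  then have "a ^ P * (w1 ^ P * w2 ^ P) = b - b ^ P * (w1 ^ P * w2 ^ P) * (w1 ^ P + w2 ^ P)"
    by (simp only: power_mult_distrib diff add conj_conj)
  then show ?thesis
    using alg[of "w1 ^ P" "w2 ^ P" "b ^ P" "a ^ P"] w r by (simp add: selfrec_def)
qed

text \<open>One direction uses the combination of the two values in which \<open>a ^ P\<close>
  cancels, the other the factorisation. Two roots thus leave \<open>b\<close> free and determine
  \<open>a\<close>.\<close>

lemma selfrec_root2:
  assumes w: "w1 ^ (P + 1) = 1" "w2 ^ (P + 1) = 1" "w1 \<noteq> w2"
  shows "selfrec (a, b) w1 = 0 \<and> selfrec (a, b) w2 = 0 \<longleftrightarrow>
    a * (w1 * w2) = b ^ P - b * (w1 * w2) * (w1 + w2)" (is "?l \<longleftrightarrow> ?r")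
proof
  have "w2 * (b * w1 ^ 3 + a * w1 ^ 2 + A * w1 + B) - w1 * (b * w2 ^ 3 + a * w2 ^ 2 + A * w2 + B)
      = (w1 - w2) * (a * (w1 * w2) - (B - b * (w1 * w2) * (w1 + w2)))" for A B
    by (simp add: algebra_simps power2_eq_square power3_eq_cube)
  from this[of "a ^ P" "b ^ P"]
  have "w2 * selfrec (a, b) w1 - w1 * selfrec (a, b) w2
      = (w1 - w2) * (a * (w1 * w2) - (b ^ P - b * (w1 * w2) * (w1 + w2)))"
    by (simp add: selfrec_def)
  then show ?r if ?l
    using that w by simp
next
  assume r: ?r
  have nz: "w1 \<noteq> 0" "w2 \<noteq> 0"
    using w by auto
  show ?l
    using selfrec_factor[OF w(1,2) r, of w1] selfrec_factor[OF w(1,2) r, of w2] nz by simp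
qed

text \<open>A root other than \<open>w1\<close> and \<open>w2\<close> must annihilate the remaining
  linear factor. What is left is a twisted fixed-point equation for \<open>b\<close>.\<close>

lemma selfrec_root3:
  assumes w: "w1 ^ (P + 1) = 1" "w2 ^ (P + 1) = 1" "w1 \<noteq> w2" "w3 \<noteq> w1" "w3 \<noteq> w2"
    and r: "a * (w1 * w2) = b ^ P - b * (w1 * w2) * (w1 + w2)"
  shows "selfrec (a, b) w3 = 0 \<longleftrightarrow> b ^ P = - (b * (w1 * w2 * w3))"
proof -
  have nz: "w1 \<noteq> 0" "w2 \<noteq> 0"
    using w by auto
  show ?thesis
    using selfrec_factor[OF w(1,2) r, of w3] nz w by (auto simp: eq_neg_iff_add_eq_0)
qed

section \<open>Numbers of cubics with prescribed roots\<close>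

lemma card_selfrec_roots_1:
  assumes w: "w ^ (P + 1) = 1"
  shows "card {v. selfrec v w = 0} = P ^ 3"
proof -
  \<comment> \<open>In the coordinates \<open>c = a + b * w\<close> and \<open>b\<close>, only
    \<open>c\<close> is constrained.\<close>
  have "bij_betw (\<lambda>(a, b). (a + b * w, b)) {v. selfrec v w = 0} ({c. c ^ P = - (c * w)} \<times> UNIV)"
    by (rule bij_betw_byWitness[where f' = "\<lambda>(c, b). (c - b * w, b)"])
       (auto simp: selfrec_root1[OF w])
  then have "card {v. selfrec v w = 0} = card {c. c ^ P = - (c * w)} * CARD('a)"
    by (simp add: bij_betw_same_card card_cartesian_product)
  then show ?thesis
    using card_twisted_fixed[OF w] by (simp add: card power3_eq_cube power2_eq_square)
qed

lemma card_selfrec_roots_2: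
  assumes w: "w1 ^ (P + 1) = 1" "w2 ^ (P + 1) = 1" "w1 \<noteq> w2"
  shows "card {v. selfrec v w1 = 0 \<and> selfrec v w2 = 0} = P ^ 2"
proof -
  have nz: "w1 \<noteq> 0" "w2 \<noteq> 0"
    using w by auto
  have "{v. selfrec v w1 = 0 \<and> selfrec v w2 = 0}
      = {(a, b). a * (w1 * w2) = b ^ P - b * (w1 * w2) * (w1 + w2)}"
    unfolding set_eq_iff mem_Collect_eq split_paired_All case_prod_conv
    using selfrec_root2[OF w] by blast
  also have "bij_betw snd \<dots> UNIV"
    by (rule bij_betw_byWitness
        [where f' = "\<lambda>b. ((b ^ P - b * (w1 * w2) * (w1 + w2)) / (w1 * w2), b)"])
       (use nz in \<open>auto simp: nonzero_divide_eq_eq nonzero_eq_divide_eq\<close>)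
  finally show ?thesis
    by (simp add: bij_betw_same_card card)
qed

lemma card_selfrec_roots_3:
  assumes w: "w1 ^ (P + 1) = 1" "w2 ^ (P + 1) = 1" "w3 ^ (P + 1) = 1"
    and ne: "w1 \<noteq> w2" "w3 \<noteq> w1" "w3 \<noteq> w2"
  shows "card {v. selfrec v w1 = 0 \<and> selfrec v w2 = 0 \<and> selfrec v w3 = 0} = P"
proof -
  have nz: "w1 \<noteq> 0" "w2 \<noteq> 0"
    using w by auto
  \<comment> \<open>With norm 1 for the product, \<open>card_twisted_fixed\<close> leaves
    \<open>P\<close> choices of \<open>b\<close>, each of which fixes \<open>a\<close>.\<close>
  have p: "(w1 * w2 * w3) ^ (P + 1) = 1"
    unfolding power_mult_distrib w by simp
  have "{v. selfrec v w1 = 0 \<and> selfrec v w2 = 0 \<and> selfrec v w3 = 0}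
      = {(a, b). a * (w1 * w2) = b ^ P - b * (w1 * w2) * (w1 + w2) \<and> b ^ P = - (b * (w1 * w2 * w3))}"
    unfolding set_eq_iff mem_Collect_eq split_paired_All case_prod_conv
    using selfrec_root2[OF w(1,2) ne(1)] selfrec_root3[OF w(1,2) ne] by blast
  also have "\<dots> = (\<lambda>b. ((b ^ P - b * (w1 * w2) * (w1 + w2)) / (w1 * w2), b)) ` {b. b ^ P = - (b * (w1 * w2 * w3))}"
    (is "_ = ?g ` ?B")
  proof -
    have "a * (w1 * w2) = y \<longleftrightarrow> a = y / (w1 * w2)" for a y
      using nz by (simp add: nonzero_eq_divide_eq)
    then show ?thesis
      by (simp only: image_def) blast
  qed
  finally show ?thesis
    using card_image[of ?g ?B] card_twisted_fixed[OF p] by (simp add: inj_on_def)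
qed

lemma card_common_roots:
  assumes W: "W \<subseteq> {w. w ^ (P + 1) = 1}" "card W \<in> {1, 2, 3}"
  shows "card {v. v \<noteq> (0, 0) \<and> (\<forall>w\<in>W. selfrec v w = 0)} = P ^ (4 - card W) - 1"
proof -
  have "card {v. \<forall>w\<in>W. selfrec v w = 0} = P ^ (4 - card W)"
  proof -
    consider w where "W = {w}" | w1 w2 where "W = {w1, w2}" "w1 \<noteq> w2"
      | w1 w2 w3 where "W = {w1, w2, w3}" "w1 \<noteq> w2" "w3 \<noteq> w1" "w3 \<noteq> w2"
      using W(2) by (auto simp: card_1_singleton_iff card_2_iff card_3_iff)
    then show ?thesis
      by cases (use W(1) in \<open>auto simp: card_selfrec_roots_1 card_selfrec_roots_2 card_selfrec_roots_3\<close>)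
  qed
  moreover have "{v. v \<noteq> (0, 0) \<and> (\<forall>w\<in>W. selfrec v w = 0)} = {v. \<forall>w\<in>W. selfrec v w = 0} - {(0, 0)}"
    by auto
  moreover have "(0, 0) \<in> {v. \<forall>w\<in>W. selfrec v w = 0}"
    using P_gt_1 by (auto simp: selfrec_def zero_power)
  ultimately show ?thesis
    by (simp add: card_Diff_singleton)
qed

section \<open>Binomial moments of the number of roots\<close>

definition root_count :: "'a set \<Rightarrow> 'a \<times> 'a \<Rightarrow> nat" where
  "root_count H v = card {w \<in> H. selfrec v w = 0}"

lemma root_count_le_3:
  assumes "v \<noteq> (0, 0)"
  shows "root_count H v \<le> 3"
proof -
  obtain a b where v: "v = (a, b)"
    by (cases v)
  have "[:b ^ P, a ^ P, a, b:] \<noteq> 0"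
    using assms v by auto
  then have "card {w. poly [:b ^ P, a ^ P, a, b:] w = 0} \<le> degree [:b ^ P, a ^ P, a, b:]"
    by (rule card_poly_roots_bound)
  also have "\<dots> \<le> 3"
    by (simp add: degree_pCons_eq_if)
  also have "{w. poly [:b ^ P, a ^ P, a, b:] w = 0} = {w. selfrec v w = 0}"
    by (simp add: v selfrec_def algebra_simps power2_eq_square power3_eq_cube)
  finally have "card {w. selfrec v w = 0} \<le> 3" .
  moreover have "root_count H v \<le> card {w. selfrec v w = 0}"
    unfolding root_count_def by (rule card_mono) auto
  ultimately show ?thesis by simp
qed

text \<open>Double counting of pairs \<open>(v, W)\<close> with \<open>W\<close> a
  \<open>k\<close>-subset of \<open>H\<close> consisting of roots of \<open>v\<close>; the number of
  \<open>v\<close> for a given \<open>W\<close> depends on \<open>k\<close> alone.\<close>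

lemma sum_root_count_choose:
  assumes H: "H \<subseteq> {w. w ^ (P + 1) = 1}" and k: "k \<in> {1, 2, 3}"
  shows "(\<Sum>v | v \<noteq> (0, 0). root_count H v choose k) = (card H choose k) * (P ^ (4 - k) - 1)"
proof -
  have "(\<Sum>v | v \<noteq> (0, 0). root_count H v choose k)
      = (\<Sum>v | v \<noteq> (0, 0). card {W \<in> {W. W \<subseteq> H \<and> card W = k}. \<forall>w\<in>W. selfrec v w = 0})"
  proof (rule sum.cong[OF refl])
    fix v
    have "{W \<in> {W. W \<subseteq> H \<and> card W = k}. \<forall>w\<in>W. selfrec v w = 0}
        = {W. W \<subseteq> {w \<in> H. selfrec v w = 0} \<and> card W = k}"
      by auto
    then show "root_count H v choose k = card {W \<in> {W. W \<subseteq> H \<and> card W = k}. \<forall>w\<in>W. selfrec v w = 0}"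
      by (simp add: root_count_def n_subsets)
  qed
  also have "\<dots> = (\<Sum>W | W \<subseteq> H \<and> card W = k. card {v \<in> {v. v \<noteq> (0, 0)}. \<forall>w\<in>W. selfrec v w = 0})"
    by (rule sum_multicount_gen[symmetric]) simp_all
  also have "\<dots> = (\<Sum>W | W \<subseteq> H \<and> card W = k. P ^ (4 - k) - 1)"
  proof (rule sum.cong[OF refl])
    fix W assume "W \<in> {W. W \<subseteq> H \<and> card W = k}"
    then show "card {v \<in> {v. v \<noteq> (0, 0)}. \<forall>w\<in>W. selfrec v w = 0} = P ^ (4 - k) - 1"
      using card_common_roots[of W] H k by auto
  qed
  finally show ?thesis
    by (simp add: n_subsets)
qed

text \<open>The moments of orders 0 to 3 form a triangular system: a nonzero pair has at most three
  roots, and the coefficient of \<open>N j\<close> in the moment of order \<open>k\<close> is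
  \<open>j choose k\<close>.\<close>

lemma root_count_moments:
  fixes H
  assumes H: "H \<subseteq> {w. w ^ (P + 1) = 1}"
  defines "N \<equiv> \<lambda>j. card {v. v \<noteq> (0, 0) \<and> root_count H v = j}"
  shows "N 0 + N 1 + N 2 + N 3 = P ^ 4 - 1"
    and "N 1 + 2 * N 2 + 3 * N 3 = card H * (P ^ 3 - 1)"
    and "N 2 + 3 * N 3 = (card H choose 2) * (P ^ 2 - 1)"
    and "N 3 = (card H choose 3) * (P - 1)"
proof -
  have group: "(\<Sum>v | v \<noteq> (0, 0). g (root_count H v)) = g 0 * N 0 + g 1 * N 1 + g 2 * N 2 + g 3 * N 3"
    for g :: "nat \<Rightarrow> nat"
  proof -
    have "(\<Sum>v | v \<noteq> (0, 0). g (root_count H v))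
        = (\<Sum>j\<in>{0, 1, 2, 3}. \<Sum>v | v \<in> {v. v \<noteq> (0, 0)} \<and> root_count H v = j. g (root_count H v))"
    proof (rule sum.group[symmetric])
      show "root_count H ` {v. v \<noteq> (0, 0)} \<subseteq> {0, 1, 2, 3}"
      proof (rule image_subsetI)
        fix v :: "'a \<times> 'a" assume "v \<in> {v. v \<noteq> (0, 0)}"
        then have "root_count H v \<le> 3"
          by (simp add: root_count_le_3)
        then have "root_count H v = 0 \<or> root_count H v = 1 \<or> root_count H v = 2 \<or> root_count H v = 3"
          by arith
        then show "root_count H v \<in> {0, 1, 2, 3}"
          by simp
      qed
    qed simp_all
    also have "\<dots> = (\<Sum>j\<in>{0, 1, 2, 3}. g j * N j)"
      by (intro sum.cong refl) (simp add: N_def)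
    finally show ?thesis by simp
  qed
  have "(\<Sum>v::'a \<times> 'a | v \<noteq> (0, 0). 1) = P ^ 4 - 1"
  proof -
    have "{v::'a \<times> 'a. v \<noteq> (0, 0)} = UNIV - {(0, 0)}" by auto
    then show ?thesis
      by (simp add: card_Diff_singleton card_cartesian_product card flip: UNIV_Times_UNIV power_add)
  qed
  then show "N 0 + N 1 + N 2 + N 3 = P ^ 4 - 1"
    using group[of "\<lambda>_. 1"] by simp
  show "N 1 + 2 * N 2 + 3 * N 3 = card H * (P ^ 3 - 1)"
    using group[of "\<lambda>j. j choose 1"] sum_root_count_choose[OF H, of 1] by simp
  show "N 2 + 3 * N 3 = (card H choose 2) * (P ^ 2 - 1)"
    using group[of "\<lambda>j. j choose 2"] sum_root_count_choose[OF H, of 2] by (simp add: numeral_eq_Suc)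
  show "N 3 = (card H choose 3) * (P - 1)"
    using group[of "\<lambda>j. j choose 3"] sum_root_count_choose[OF H, of 3] by (simp add: numeral_eq_Suc)
qed

section \<open>Power maps on the elements of norm 1\<close>

lemma card_minus_1: "CARD('a) - 1 = (P + 1) * (P - 1)"
  by (simp add: card power2_eq_square algebra_simps)

text \<open>Bezout gives an inverse \<open>x\<close> of \<open>e1 = e / g\<close> modulo
  \<open>M\<close>. Raising to the power \<open>x\<close> then replaces both conditions on
  \<open>z\<close> by the single equation \<open>z ^ g = w ^ x\<close>.\<close>

lemma card_unit_power_fibre:
  assumes g: "g = gcd e (P + 1)" "g * M = P + 1" and e: "e > 0" and w: "w ^ M = 1"
  shows "card {z::'a. z ^ (P + 1) = 1 \<and> z ^ e = w} = g"
proof -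
  obtain x y where xy: "e * x = (P + 1) * y + g"
    using bezout_nat[of e "P + 1"] e g(1) by auto
  obtain e1 where e1: "e = g * e1"
    using g(1) by (metis dvdE gcd_dvd1)
  have "g > 0"
    using e g(1) by simp
  moreover have "g * (e1 * x) = g * (M * y + 1)"
    using xy e1 g(2) by (metis distrib_left mult.assoc mult_1_right)
  ultimately have bez: "e1 * x = M * y + 1"
    by (metis mult_cancel1 not_gr_zero)
  have "{z. z ^ (P + 1) = 1 \<and> z ^ e = w} = {z. z ^ g = w ^ x}"
  proof (intro Set.set_eqI iffI; clarify)
    fix z :: 'a assume z: "z ^ (P + 1) = 1" "w = z ^ e"
    have "(z ^ e) ^ x = (z ^ (P + 1)) ^ y * z ^ g"
      by (simp only: xy flip: power_mult power_add)
    then show "z ^ g = (z ^ e) ^ x"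
      using z(1) by simp
  next
    fix z :: 'a assume z: "z ^ g = w ^ x"
    have "z ^ (P + 1) = (w ^ M) ^ x"
      using z by (metis g(2) mult.commute power_mult)
    moreover have "z ^ e = w ^ (e1 * x)"
      using z by (metis e1 mult.commute power_mult)
    then have "z ^ e = (w ^ M) ^ y * w"
      by (simp add: bez power_mult)
    ultimately show "z ^ (P + 1) = 1 \<and> z ^ e = w"
      using w by simp
  qed
  moreover have "card {z. z ^ g = w ^ x} = g"
  proof (rule card_power_eq)
    show "g * (M * (P - 1)) = CARD('a) - 1"
      unfolding card_minus_1 g(2)[symmetric] by simp
    show "(w ^ x) ^ (M * (P - 1)) = 1"
      using w by (metis mult.commute power_mult power_one)
  qed
  ultimately show ?thesis
    by simp
qed

lemma card_unit_power_selfrec: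
  assumes g: "g = gcd e (P + 1)" "g * M = P + 1" and e: "e > 0"
  shows "card {z. z ^ (P + 1) = 1 \<and> selfrec v (z ^ e) = 0} = g * card {w. w ^ M = 1 \<and> selfrec v w = 0}"
proof -
  obtain e1 where e1: "e = g * e1"
    using g(1) by (metis dvdE gcd_dvd1)
  have "(z ^ e) ^ M = 1" if "z ^ (P + 1) = 1" for z :: 'a
  proof -
    have "(z ^ e) ^ M = (z ^ (P + 1)) ^ e1"
      unfolding g(2)[symmetric] e1 by (simp add: mult_ac flip: power_mult)
    then show ?thesis using that by simp
  qed
  then have U: "{z. z ^ (P + 1) = 1 \<and> selfrec v (z ^ e) = 0}
      = (\<Union>w\<in>{w. w ^ M = 1 \<and> selfrec v w = 0}. {z. z ^ (P + 1) = 1 \<and> z ^ e = w})"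
    by blast
  have "card (\<Union>w\<in>{w. w ^ M = 1 \<and> selfrec v w = 0}. {z. z ^ (P + 1) = 1 \<and> z ^ e = w})
      = (\<Sum>w | w ^ M = 1 \<and> selfrec v w = 0. card {z. z ^ (P + 1) = 1 \<and> z ^ e = w})"
    by (rule card_UN_disjoint) auto
  also have "\<dots> = (\<Sum>w | w ^ M = 1 \<and> selfrec v w = 0. g)"
    using card_unit_power_fibre[OF g e] by (intro sum.cong) auto
  finally show ?thesis
    unfolding U by simp
qed

text \<open>
  The trace from \<open>F\<^bsub>q\<^esub>\<close> to \<open>F\<^bsub>P\<^esub>\<close> of \<open>a x\<^bsup>d1\<^esup> + b x\<^bsup>d2\<^esup>\<close>, with \<open>t = 4 h + 2\<close>, so that
  \<open>s1 = h + 1\<close> and \<open>s2 = 3 h + 2\<close>.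
\<close>

definition trace_form :: "nat \<Rightarrow> 'a \<times> 'a \<Rightarrow> 'a \<Rightarrow> 'a" where
  "trace_form h v x =
     (let y = fst v * x ^ ((h + 1) * (P - 1) + 1) + snd v * x ^ ((3 * h + 2) * (P - 1) + 1)
      in y + y ^ P)"

lemma trace_form_fixed: "trace_form h v x ^ P = trace_form h v x"
  by (simp add: trace_form_def Let_def add conj_conj add.commute)

text \<open>Both exponents are 1 modulo \<open>P - 1\<close>, so a nonzero \<open>y\<close> of the
  subfield leaves each power unchanged, and conjugation fixes it.\<close>

lemma trace_form_scale:
  assumes "y ^ (P - 1) = 1"
  shows "trace_form h v (y * x) = y * trace_form h v x"
proof -
  have d: "(y * x) ^ (k * (P - 1) + 1) = y * x ^ (k * (P - 1) + 1)" for k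
    using assms by (simp add: power_mult_distrib power_mult mult.commute[of k])
  have P: "y ^ P = y"
    using assms P_gt_1 power_minus_mult[of P y] by simp
  show ?thesis
    unfolding trace_form_def Let_def d
    by (simp add: add power_mult_distrib P algebra_simps)
qed

text \<open>Conjugation sends \<open>x\<close> to \<open>x * z\<close> and inverts \<open>z\<close>,
  so the form is \<open>x\<close> times a Laurent polynomial in \<open>z\<close> with exponents
  \<open>3 * h + 2\<close>, \<open>h + 1\<close>, \<open>- h\<close>, \<open>- (3 * h + 1)\<close>.
  Shifting by \<open>3 * h + 1\<close> makes them 3, 2, 1, 0 times \<open>2 * h + 1\<close>.\<close>

lemma trace_form_selfrec:
  assumes z: "x ^ (P - 1) = z" and x: "x \<noteq> 0"
  shows "trace_form h (a, b) x * z ^ (3 * h + 1) = x * selfrec (a, b) (z ^ (2 * h + 1))"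
proof -
  define zb where "zb = z ^ P"
  have xP: "x ^ P = x * z"
    using z P_gt_1 power_minus_mult[of P x] by (simp add: mult.commute)
  have "(x * z) ^ P = x"
    using conj_conj[of x] xP by simp
  then have "x * (z * zb) = x"
    by (simp add: power_mult_distrib xP zb_def)
  then have zz: "z * zb = 1"
    using x by simp
  have pw: "x ^ (k * (P - 1) + 1) = x * z ^ k" for k
    using z by (metis mult.commute power_add power_mult power_one_right)
  have pc: "(z ^ k) ^ P = zb ^ k" for k
    by (simp add: zb_def mult.commute flip: power_mult)
  have zbk: "z ^ k * zb ^ k = 1" for k
    using zz by (simp flip: power_mult_distrib)
  have "trace_form h (a, b) x * z ^ (3 * h + 1)
     = a * (x * z ^ (h + 1)) * z ^ (3 * h + 1) + b * (x * z ^ (3 * h + 2)) * z ^ (3 * h + 1)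
       + a ^ P * (x * z * zb ^ (h + 1)) * z ^ (3 * h + 1)
       + b ^ P * (x * z * zb ^ (3 * h + 2)) * z ^ (3 * h + 1)"
    unfolding trace_form_def Let_def pw fst_conv snd_conv add power_mult_distrib xP pc
    by (simp only: distrib_right distrib_left mult.assoc add.assoc)
  also have "a ^ P * (x * z * zb ^ (h + 1)) * z ^ (3 * h + 1) = x * (a ^ P * z ^ (2 * h + 1))"
  proof -
    have e: "z * z ^ (3 * h + 1) = z ^ (2 * h + 1) * z ^ (h + 1)"
      by (simp flip: power_add power_Suc)
    have "a ^ P * (x * z * zb ^ (h + 1)) * z ^ (3 * h + 1)
        = x * (a ^ P * ((z * z ^ (3 * h + 1)) * zb ^ (h + 1)))"
      by (simp only: mult_ac)
    then show ?thesis
      by (simp only: e mult.assoc zbk mult_1_right)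
  qed
  also have "b ^ P * (x * z * zb ^ (3 * h + 2)) * z ^ (3 * h + 1) = x * b ^ P"
  proof -
    have e: "z * z ^ (3 * h + 1) = z ^ (3 * h + 2)"
      by (simp flip: power_Suc)
    have "b ^ P * (x * z * zb ^ (3 * h + 2)) * z ^ (3 * h + 1)
        = x * (b ^ P * ((z * z ^ (3 * h + 1)) * zb ^ (3 * h + 2)))"
      by (simp only: mult_ac)
    then show ?thesis
      by (simp only: e zbk mult_1_right)
  qed
  also have "a * (x * z ^ (h + 1)) * z ^ (3 * h + 1) = x * (a * (z ^ (2 * h + 1))\<^sup>2)"
  proof -
    have "2 * (2 * h + 1) = (h + 1) + (3 * h + 1)"
      by simp
    then have e: "(z ^ (2 * h + 1))\<^sup>2 = z ^ (h + 1) * z ^ (3 * h + 1)"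
      by (metis mult.commute power_add power_mult)
    show ?thesis
      unfolding e by (simp only: mult_ac)
  qed
  also have "b * (x * z ^ (3 * h + 2)) * z ^ (3 * h + 1) = x * (b * (z ^ (2 * h + 1)) ^ 3)"
  proof -
    have "3 * (2 * h + 1) = (3 * h + 2) + (3 * h + 1)"
      by simp
    then have e: "(z ^ (2 * h + 1)) ^ 3 = z ^ (3 * h + 2) * z ^ (3 * h + 1)"
      by (metis mult.commute power_add power_mult)
    show ?thesis
      unfolding e by (simp only: mult_ac)
  qed
  finally show ?thesis
    by (simp add: selfrec_def algebra_simps)
qed

lemma trace_form_eq_0_iff:
  assumes "x \<noteq> 0"
  shows "trace_form h v x = 0 \<longleftrightarrow> selfrec v ((x ^ (P - 1)) ^ (2 * h + 1)) = 0"
  using trace_form_selfrec[OF refl assms, of h "fst v" "snd v"] assms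
  by (metis (no_types, lifting) mult_eq_0_iff power_not_zero prod.collapse)

text \<open>Sort the nonzero \<open>x\<close> by \<open>z = x ^ (P - 1)\<close>, which has norm 1.
  Over each \<open>z\<close> the form either vanishes throughout, and \<open>T 0\<close> fails, or
  takes every nonzero value of the subfield exactly once.\<close>

lemma card_trace_form:
  assumes T: "\<not> T 0" and g: "g = gcd (2 * h + 1) (P + 1)" "g * M = P + 1"
  shows "card {x. x \<noteq> 0 \<and> T (trace_form h v x)}
    = (P + 1 - g * card {w. w ^ M = 1 \<and> selfrec v w = 0}) * card {y::'a. y ^ P = y \<and> T y}"
proof -
  let ?K = "{y::'a. y ^ P = y \<and> T y}"
  let ?Z = "{z. z ^ (P + 1) = 1 \<and> selfrec v (z ^ (2 * h + 1)) \<noteq> 0}"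
  have fermat: "(x ^ (P - 1)) ^ (P + 1) = 1" if "x \<noteq> 0" for x :: 'a
  proof -
    have "x * x ^ (CARD('a) - 1) = x * 1"
      using finite_field_power_card_eq_same[of x] by (simp flip: power_Suc)
    then have "x ^ (CARD('a) - 1) = 1"
      using that by (simp only: mult_cancel_left) simp
    then show ?thesis
      by (metis card_minus_1 mult.commute power_mult)
  qed
  have fibre: "card {x. x ^ (P - 1) = z \<and> T (trace_form h v x)} = card ?K" if z: "z \<in> ?Z" for z
  proof -
    have "card {x. x ^ (P - 1) = z} = P - 1"
      by (rule card_power_eq[where r = "P + 1"]) (use z in \<open>simp_all only: card_minus_1 mult.commute mem_Collect_eq\<close>)
    then have "{x. x ^ (P - 1) = z} \<noteq> {}"
      using P_gt_1 by force
    then obtain x0 where x0: "x0 ^ (P - 1) = z"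
      by blast
    have "x0 \<noteq> 0"
      using z x0 P_gt_1 by (auto simp: zero_power)
    define u where "u = trace_form h v x0"
    have u: "u \<noteq> 0" "u ^ P = u"
      using z x0 \<open>x0 \<noteq> 0\<close> by (auto simp: u_def trace_form_eq_0_iff trace_form_fixed)
    have "z \<noteq> 0"
      using z by auto
    have fix1: "y ^ (P - 1) = 1 \<longleftrightarrow> y ^ P = y" if "y \<noteq> 0" for y :: 'a
    proof -
      have "y ^ P = y ^ (P - 1) * y"
        using P_gt_1 power_minus_mult[of P y] by simp
      then show ?thesis
        using that by simp
    qed
    have scale: "trace_form h v (y * x0) = y * u" if "y ^ (P - 1) = 1" for y
      using trace_form_scale[OF that] by (simp add: u_def)
    \<comment> \<open>Every \<open>x\<close> over \<open>z\<close> is \<open>x0\<close> times a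
      nonzero element of the subfield, and by homogeneity the form scales \<open>u\<close> by that
      element; hence the inverse \<open>y / u * x0\<close>.\<close>
    have "bij_betw (trace_form h v) {x. x ^ (P - 1) = z \<and> T (trace_form h v x)} ?K"
    proof (rule bij_betw_byWitness[where f' = "\<lambda>y. y / u * x0"])
      have quot: "(x / x0) ^ (P - 1) = 1" if "x ^ (P - 1) = z" for x
        using that x0 \<open>z \<noteq> 0\<close> by (simp add: power_divide)
      show "\<forall>x\<in>{x. x ^ (P - 1) = z \<and> T (trace_form h v x)}. trace_form h v x / u * x0 = x"
        using scale[OF quot] u \<open>x0 \<noteq> 0\<close> by simp
      have quot': "(y / u) ^ (P - 1) = 1" if "y \<in> ?K" for y
        using that T u by (subst fix1) (auto simp: power_divide)
      show "\<forall>y\<in>?K. trace_form h v (y / u * x0) = y"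
        using scale[OF quot'] u by simp
      show "trace_form h v ` {x. x ^ (P - 1) = z \<and> T (trace_form h v x)} \<subseteq> ?K"
        by (simp add: image_subset_iff trace_form_fixed)
      show "(\<lambda>y. y / u * x0) ` ?K \<subseteq> {x. x ^ (P - 1) = z \<and> T (trace_form h v x)}"
      proof (rule image_subsetI)
        fix y assume y: "y \<in> ?K"
        show "y / u * x0 \<in> {x. x ^ (P - 1) = z \<and> T (trace_form h v x)}"
          unfolding mem_Collect_eq power_mult_distrib scale[OF quot'[OF y]] quot'[OF y] x0
          using y u by simp
      qed
    qed
    then show ?thesis
      by (rule bij_betw_same_card)
  qed
  have U: "{x. x \<noteq> 0 \<and> T (trace_form h v x)} = (\<Union>z\<in>?Z. {x. x ^ (P - 1) = z \<and> T (trace_form h v x)})"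
  proof (intro Set.set_eqI iffI)
    fix x assume "x \<in> {x. x \<noteq> 0 \<and> T (trace_form h v x)}"
    then have x: "x \<noteq> 0" "T (trace_form h v x)" by auto
    have "trace_form h v x \<noteq> 0"
      using x(2) T by (cases "trace_form h v x = 0") simp_all
    then have "x ^ (P - 1) \<in> ?Z"
      using fermat[OF x(1)] trace_form_eq_0_iff[OF x(1)] by blast
    then show "x \<in> (\<Union>z\<in>?Z. {x. x ^ (P - 1) = z \<and> T (trace_form h v x)})"
      using x by blast
  next
    fix x assume "x \<in> (\<Union>z\<in>?Z. {x. x ^ (P - 1) = z \<and> T (trace_form h v x)})"
    then have "(x ^ (P - 1)) ^ (P + 1) = 1" "T (trace_form h v x)" by auto
    then show "x \<in> {x. x \<noteq> 0 \<and> T (trace_form h v x)}"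
      using P_gt_1 by (auto simp: zero_power)
  qed
  have "card (\<Union>z\<in>?Z. {x. x ^ (P - 1) = z \<and> T (trace_form h v x)}) =
      (\<Sum>z\<in>?Z. card {x. x ^ (P - 1) = z \<and> T (trace_form h v x)})"
    by (rule card_UN_disjoint) auto
  also have "\<dots> = (\<Sum>z\<in>?Z. card ?K)"
    by (rule sum.cong[OF refl fibre])
  also have "\<dots> = card ?Z * card ?K"
    by simp
  finally have "card {x. x \<noteq> 0 \<and> T (trace_form h v x)} = card ?Z * card ?K"
    unfolding U .
  moreover have "card ?Z = P + 1 - g * card {w. w ^ M = 1 \<and> selfrec v w = 0}"
  proof -
    have "card {z::'a. z ^ (P + 1) = 1} = P + 1"
      by (rule card_power_eq[where r = "P - 1"]) (simp_all only: card_minus_1 power_one)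
    moreover have "?Z = {z. z ^ (P + 1) = 1} - {z. z ^ (P + 1) = 1 \<and> selfrec v (z ^ (2 * h + 1)) = 0}"
      by blast
    moreover have "{z. z ^ (P + 1) = 1 \<and> selfrec v (z ^ (2 * h + 1)) = 0} \<subseteq> {z. z ^ (P + 1) = 1}"
      by blast
    ultimately show ?thesis
      using card_unit_power_selfrec[OF g, of v] card_Diff_subset[of "{z. z ^ (P + 1) = 1 \<and> selfrec v (z ^ (2 * h + 1)) = 0}"]
      by simp
  qed
  ultimately show ?thesis
    by simp
qed

end

section \<open>Linear and cyclic codes over finite fields\<close>

text \<open>Coordinates in a finite basis, which exists because the finite carrier spans
  itself.\<close>

lemma (in vectorspace) card_carrier_eq:
  assumes fin: "finite (carrier V)"
  shows "card (carrier V) = card (carrier K) ^ dim"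
proof -
  have "span (carrier V) = carrier V"
    using in_own_span span_is_subset2 by (metis subset_antisym subset_refl)
  then have "fin_dim"
    unfolding fin_dim_def using fin by blast
  then obtain B where B: "finite B" "basis B"
    using finite_basis_exists by blast
  then have BV: "B \<subseteq> carrier V"
    by (simp add: basis_def)
  have uniq: "\<exists>!a. a \<in> B \<rightarrow>\<^sub>E carrier K \<and> lincomb a B = v" if "v \<in> carrier V" for v
    using basis_criterion[OF B(1) BV] B(2) that by blast
  have "bij_betw (\<lambda>a. lincomb a B) (B \<rightarrow>\<^sub>E carrier K) (carrier V)"
  proof (rule bij_betw_imageI)
    have cl: "lincomb a B \<in> carrier V" if "a \<in> B \<rightarrow>\<^sub>E carrier K" for a
      using that BV by (intro lincomb_closed) (auto simp: PiE_def)
    show "inj_on (\<lambda>a. lincomb a B) (B \<rightarrow>\<^sub>E carrier K)"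
    proof (rule inj_onI)
      fix a b assume ab: "a \<in> B \<rightarrow>\<^sub>E carrier K" "b \<in> B \<rightarrow>\<^sub>E carrier K" "lincomb a B = lincomb b B"
      then show "a = b"
        using uniq[OF cl[OF ab(1)]] by (metis (no_types, lifting))
    qed
    show "(\<lambda>a. lincomb a B) ` (B \<rightarrow>\<^sub>E carrier K) = carrier V"
      using cl uniq by (auto simp: image_iff) metis
  qed
  then have "card (carrier V) = card (B \<rightarrow>\<^sub>E carrier K)"
    by (simp add: bij_betw_same_card)
  also have "\<dots> = card (carrier K) ^ card B"
    using B(1) by (simp add: card_PiE)
  finally show ?thesis
    using dim_basis[OF B] by simp
qed

lemma subspace_dual_code:
  fixes C :: "'a::field vec set"
  assumes "C \<subseteq> carrier_vec N"
  shows "subspace class_ring (dual_code N C) (module_vec TYPE('a) N)"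
proof -
  interpret vec_space "TYPE('a)" N .
  show ?thesis
    unfolding subspace_def
  proof (intro conjI)
    show "vectorspace class_ring (module_vec TYPE('a) N)"
      by (rule vectorspace_axioms)
    show "submodule class_ring (dual_code N C) (module_vec TYPE('a) N)"
      using assms
      by unfold_locales
        (auto simp: module_vec_simps orthogonal_complement_def add_scalar_prod_distrib smult_scalar_prod_distrib subset_iff)
  qed
qed

text \<open>The dimension is read off from the cardinality, as powers of a base at least 2 determine
  their exponents.\<close>

lemma dim_dual_code:
  fixes C :: "'a::{field, finite} vec set"
  assumes "C \<subseteq> carrier_vec N" and "card (dual_code N C) = CARD('a) ^ k"
  shows "vectorspace.dim class_ring ((module_vec TYPE('a) N)\<lparr>carrier := dual_code N C\<rparr>) = k"
proof -
  interpret V: vec_space "TYPE('a)" N .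
  interpret W: vectorspace "class_ring :: 'a ring" "(module_vec TYPE('a) N)\<lparr>carrier := dual_code N C\<rparr>"
    by (rule V.subspace_is_vs[OF subspace_dual_code[OF assms(1)]])
  have "finite (dual_code N C)"
    by (rule finite_subset[of _ "carrier_vec N"]) (auto simp: V.orthogonal_complement_def)
  then have "CARD('a) ^ k = CARD('a) ^ W.dim"
    using W.card_carrier_eq assms(2) by (simp add: class_ring_simps)
  moreover have "card {0, 1 :: 'a} \<le> CARD('a)"
    by (rule card_mono) auto
  ultimately show ?thesis
    by simp
qed

lemma coeff_word_poly: "coeff (word_poly c) i = (if i < dim_vec c then c $ i else 0)"
proof -
  have "coeff (word_poly c) i = (\<Sum>j<dim_vec c. if j = i then c $ j else 0)"
    by (simp add: word_poly_def coeff_sum)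
  then show ?thesis
    by (simp add: sum.delta)
qed

text \<open>The shifts of \<open>g\<close> lie in the code, and orthogonality to them is a linear
  recurrence of order \<open>degree g\<close> for the entries of a dual word.\<close>

lemma card_dual_cyclic_code_le:
  fixes g :: "'a::{field, finite} poly"
  assumes "g \<noteq> 0"
  shows "card (dual_code N (cyclic_code N g)) \<le> CARD('a) ^ degree g"
proof -
  let ?D = "dual_code N (cyclic_code N g)" and ?k = "degree g"
  have D: "y \<in> carrier_vec N" "\<And>c. c \<in> cyclic_code N g \<Longrightarrow> y \<bullet> c = 0" if "y \<in> ?D" for y
    using that by (auto simp: vec_module.orthogonal_complement_def)
  let ?r = "\<lambda>y. vec ?k (\<lambda>j. if j < N then y $ j else 0)"
  \<comment> \<open>The padding by 0 in \<open>?r\<close> covers the case that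
    \<open>degree g\<close> exceeds \<open>N\<close>.\<close>
  have "inj_on ?r ?D"
  proof (rule inj_onI)
    fix y z assume y: "y \<in> ?D" and z: "z \<in> ?D" and eq: "?r y = ?r z"
    have "j < N \<longrightarrow> y $ j = z $ j" for j
    proof (induction j rule: less_induct)
      case (less j)
      show ?case
      proof (intro impI)
        assume j: "j < N"
        show "y $ j = z $ j"
        proof (cases "j < ?k")
          case True
          then have "?r y $ j = ?r z $ j"
            by (simp only: eq)
          then show ?thesis
            using True j by simp
        next
          case False
          \<comment> \<open>The shift whose leading coefficient sits at position \<open>j\<close>.
            Its degree is below \<open>N\<close>, so it is its own reduced representative.\<close>
          define c where "c = vec N (coeff (monom 1 (j - ?k) * g))"
          have ck: "coeff (monom 1 (j - ?k) * g) l = 0" if "l > j" for l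
            using that False by (simp add: coeff_monom_mult coeff_eq_0)
          have "word_poly c = monom 1 (j - ?k) * g"
            using ck j by (intro poly_eqI) (auto simp: coeff_word_poly c_def)
          then have "[word_poly c = monom 1 (j - ?k) * g] (mod (monom 1 N - 1))"
            by simp
          then have "c \<in> cyclic_code N g"
            unfolding cyclic_code_def by (auto simp only: c_def vec_carrier mem_Collect_eq)
          then have "y \<bullet> c = z \<bullet> c"
            using D y z by simp
          then have "(\<Sum>l\<in>{0..<N}. y $ l * c $ l) - (\<Sum>l\<in>{0..<N}. z $ l * c $ l) = 0"
            by (simp add: scalar_prod_def c_def)
          also have "(\<Sum>l\<in>{0..<N}. y $ l * c $ l) - (\<Sum>l\<in>{0..<N}. z $ l * c $ l)
              = (\<Sum>l\<in>{0..<N}. (y $ l - z $ l) * c $ l)"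
            by (simp add: left_diff_distrib sum_subtractf)
          also have "\<dots> = (\<Sum>l\<in>{0..<N}. if l = j then (y $ j - z $ j) * lead_coeff g else 0)"
          \<comment> \<open>Below \<open>j\<close> the entries agree by induction, above
            \<open>j\<close> the shifted polynomial has no coefficients.\<close>
          proof (rule sum.cong[OF refl])
            fix l assume "l \<in> {0..<N}"
            then show "(y $ l - z $ l) * c $ l = (if l = j then (y $ j - z $ j) * lead_coeff g else 0)"
              using less.IH[of l] ck[of l] False
              by (cases l j rule: linorder_cases) (auto simp: c_def coeff_monom_mult)
          qed
          also have "\<dots> = (y $ j - z $ j) * lead_coeff g"
            using j by simp
          finally show ?thesis
            using assms by simp
        qed
      qed
    qed
    then show "y = z"
      using D(1)[OF y] D(1)[OF z] by (intro eq_vecI) auto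
  qed
  moreover have "?r ` ?D \<subseteq> carrier_vec ?k"
    by auto
  ultimately have "card ?D \<le> card (carrier_vec ?k :: 'a vec set)"
    by (rule card_inj_on_le) simp
  then show ?thesis
    by (simp add: card_carrier_vec)
qed

section \<open>Minimal polynomials and zeros of cyclic codes\<close>

lemma is_min_poly_min_poly:
  fixes x :: "'q::finite_field"
  assumes "CARD('q) = CARD('p::prime_card) ^ n"
  shows "is_min_poly x (min_poly x :: 'p mod_ring poly)"
  unfolding min_poly_def by (rule theI'[OF ex1_min_poly[OF assms]])

text \<open>Pigeonhole: there are more polynomials of degree at most \<open>n\<close> than field
  elements, so two of them agree at \<open>x\<close>, and their difference is a nonzero polynomial
  vanishing there.\<close>

lemma degree_min_poly_le:
  fixes x :: "'q::finite_field"
  assumes q: "CARD('q) = CARD('p::prime_card) ^ n"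
  shows "degree (min_poly x :: 'p mod_ring poly) \<le> n"
proof -
  interpret field_hom "prime_embed :: 'p mod_ring \<Rightarrow> 'q"
    by (rule field_hom_prime_embed[OF CHAR_eq_CARD[OF q]])
  interpret E: map_poly_comm_ring_hom "prime_embed :: 'p mod_ring \<Rightarrow> 'q" ..
  let ?C = "carrier_vec (Suc n) :: 'p mod_ring vec set"
  let ?ev = "\<lambda>h :: 'p mod_ring poly. poly (map_poly prime_embed h) x"
  have "card ((\<lambda>c. ?ev (word_poly c)) ` ?C) \<le> CARD('q)"
    by (rule card_mono) auto
  also have "\<dots> < card ?C"
    unfolding q card_carrier_vec using prime_card[where 'a = 'p] prime_gt_1_nat by auto
  finally have "\<not> inj_on (\<lambda>c. ?ev (word_poly c)) ?C"
    by (rule pigeonhole)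
  then obtain c d where cd: "c \<in> ?C" "d \<in> ?C" "c \<noteq> d" "?ev (word_poly c) = ?ev (word_poly d)"
    by (auto simp: inj_on_def)
  let ?h = "word_poly c - word_poly d"
  obtain i where "i < Suc n" "c $ i \<noteq> d $ i"
    using cd by (metis carrier_vecD eq_vecI)
  then have "coeff ?h i \<noteq> 0"
    using cd by (simp add: coeff_word_poly)
  then have "?h \<noteq> 0"
    by force
  moreover have "?ev ?h = 0"
    using cd(4) by (simp only: E.hom_minus poly_diff right_minus_eq)
  ultimately have "degree (min_poly x :: 'p mod_ring poly) \<le> degree ?h"
    using is_min_poly_min_poly[OF q] unfolding is_min_poly_def by blast
  also have "\<dots> \<le> n"
    using cd by (intro degree_le) (auto simp: coeff_word_poly)
  finally show ?thesis .
qed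

text \<open>Evaluation at \<open>x\<close> kills both the generator and the modulus, hence does not
  depend on the representative.\<close>

lemma cyclic_code_root:
  fixes x :: "'q::finite_field" and g :: "'p::prime_card mod_ring poly"
  assumes q: "CARD('q) = CARD('p) ^ n" and x: "x ^ N = 1"
    and g: "poly (map_poly prime_embed g) x = 0" and c: "c \<in> cyclic_code N g"
  shows "(\<Sum>i<N. prime_embed (c $ i) * x ^ i) = 0"
proof -
  interpret field_hom "prime_embed :: 'p mod_ring \<Rightarrow> 'q"
    by (rule field_hom_prime_embed[OF CHAR_eq_CARD[OF q]])
  interpret E: map_poly_comm_ring_hom "prime_embed :: 'p mod_ring \<Rightarrow> 'q" ..
  let ?ev = "\<lambda>h :: 'p mod_ring poly. poly (map_poly prime_embed h) x"
  obtain a where "[word_poly c = a * g] (mod (monom 1 N - 1))" and N: "dim_vec c = N"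
    using c by (auto simp: cyclic_code_def)
  then obtain b where "word_poly c - a * g = (monom 1 N - 1) * b"
    unfolding cong_iff_dvd_diff dvd_def by blast
  then have "word_poly c = a * g + (monom 1 N - 1) * b"
    by (simp add: algebra_simps)
  then have "?ev (word_poly c) = ?ev a * ?ev g + (?ev (monom 1 N) - 1) * ?ev b"
    by (simp only: E.hom_add E.hom_mult E.hom_minus E.hom_one poly_add poly_mult poly_diff poly_1)
  also have "?ev (monom 1 N) = 1"
    using x by (simp add: map_poly_monom poly_monom)
  finally have "?ev (word_poly c) = 0"
    using g by simp
  moreover have "?ev (word_poly c) = (\<Sum>i<N. prime_embed (c $ i) * x ^ i)"
    unfolding word_poly_def N by (simp add: E.hom_sum poly_sum map_poly_monom poly_monom)
  ultimately show ?thesis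
    by simp
qed

section \<open>The trace code\<close>

locale trace_code = conjugation_field P ty_q
  for P :: nat and ty_q :: "'q::finite_field itself" +
  fixes ty_p :: "'p::prime_card itself" and m :: nat
  assumes P: "P = CARD('p) ^ m"
begin

section \<open>The prime field and the trace\<close>

lemma card_q: "CARD('q) = CARD('p) ^ (2 * m)"
  by (simp add: card P mult.commute flip: power_mult)

lemma m_pos: "m > 0"
  using P_gt_1 P by (cases m) auto

lemma CHAR_q: "CHAR('q) = CARD('p)"
  by (rule CHAR_eq_CARD[OF card_q])

lemma prime_CHAR_q: "prime CHAR('q)"
  unfolding CHAR_q by (rule prime_card)

sublocale embed: field_hom "prime_embed :: 'p mod_ring \<Rightarrow> 'q"
  by (rule field_hom_prime_embed[OF CHAR_q])

text \<open>Fermat gives one inclusion; the image already has as many elements as the polynomial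
  \<open>X ^ p - X\<close> can have roots.\<close>

lemma range_prime_embed: "range (prime_embed :: 'p mod_ring \<Rightarrow> 'q) = {s. s ^ CARD('p) = s}"
proof (rule card_seteq)
  show "range (prime_embed :: 'p mod_ring \<Rightarrow> 'q) \<subseteq> {s. s ^ CARD('p) = s}"
  proof (clarify)
    fix a :: "'p mod_ring"
    have "a ^ CARD('p) = a"
      using finite_field_power_card_eq_same[of a] by simp
    then show "(prime_embed a :: 'q) ^ CARD('p) = prime_embed a"
      by (metis embed.hom_power)
  qed
  have "card (range (prime_embed :: 'p mod_ring \<Rightarrow> 'q)) = CARD('p)"
    using embed.inj_f by (simp add: card_image)
  moreover have "card {s::'q. s ^ CARD('p) = s} \<le> CARD('p)"
  proof -
    have p: "CARD('p) > 1"
      using prime_card prime_gt_1_nat by blast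
    let ?f = "monom 1 CARD('p) - monom 1 1 :: 'q poly"
    have "coeff ?f CARD('p) = 1"
      using p by simp
    then have "?f \<noteq> 0"
      by (metis Polynomial.coeff_0 zero_neq_one)
    moreover have "degree ?f \<le> CARD('p)"
      using p by (intro degree_diff_le) (simp_all add: degree_monom_eq)
    moreover have "{s::'q. s ^ CARD('p) = s} = {s. poly ?f s = 0}"
      by (simp add: poly_monom)
    ultimately show ?thesis
      using card_poly_roots_bound by (metis order_trans)
  qed
  ultimately show "card {s::'q. s ^ CARD('p) = s} \<le> card (range (prime_embed :: 'p mod_ring \<Rightarrow> 'q))"
    by simp
qed simp

text \<open>The trace from \<open>F\<^bsub>P\<^esub>\<close> (not \<open>F\<^bsub>q\<^esub>\<close>) to the prime field.\<close>

definition trace :: "'q \<Rightarrow> 'q" where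
  "trace y = (\<Sum>j<m. y ^ (CARD('p) ^ j))"

lemma trace_0: "trace 0 = 0"
  by (simp add: trace_def zero_power)

lemma trace_add: "trace (x + y) = trace x + trace y"
  by (simp add: trace_def freshmans_dream'[OF prime_CHAR_q] CHAR_q sum.distrib)

lemma trace_sum: "trace (sum f A) = (\<Sum>a\<in>A. trace (f a))"
  by (induction A rule: infinite_finite_induct) (simp_all add: trace_0 trace_add)

lemma trace_diff: "trace (x - y) = trace x - trace y"
  using trace_add[of "x - y" y] by simp

lemma trace_scale:
  assumes "s ^ CARD('p) = s"
  shows "trace (s * y) = s * trace y"
proof -
  have "s ^ (CARD('p) ^ j) = s" for j
    using assms by (induction j) (simp_all add: power_mult)
  then show ?thesis
    by (simp add: trace_def power_mult_distrib sum_distrib_left)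
qed

text \<open>Frobenius shifts the summands by one place; the summand gained, \<open>y ^ P\<close>,
  equals the one lost, \<open>y\<close>.\<close>

lemma trace_power_CARD:
  assumes "y ^ P = y"
  shows "trace y ^ CARD('p) = trace y"
proof -
  let ?f = "\<lambda>j. y ^ (CARD('p) ^ j)"
  have "trace y ^ CARD('p) = (\<Sum>j<m. ?f (Suc j))"
    unfolding trace_def freshmans_dream_sum[OF prime_CHAR_q CHAR_q[symmetric]]
    by (simp add: mult.commute flip: power_mult)
  then have "?f 0 + trace y ^ CARD('p) = (\<Sum>j<Suc m. ?f j)"
    by (simp only: sum.lessThan_Suc_shift)
  also have "\<dots> = trace y + ?f m"
    by (simp add: trace_def)
  finally show ?thesis
    using assms P by simp
qed

lemma card_fixed: "card {y::'q. y ^ P = y} = P"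
  using card_twisted_fixed[of "-1"] odd by simp

text \<open>The trace is a polynomial of degree \<open>p ^ (m - 1)\<close>, so each of its
  \<open>p\<close> possible values on the subfield is taken at most that often; the subfield has
  \<open>p ^ m\<close> elements, so equality holds.\<close>

lemma card_trace_nonzero: "card {y. y ^ P = y \<and> trace y \<noteq> 0} = CARD('p) ^ m - CARD('p) ^ (m - 1)"
proof -
  let ?p = "CARD('p)"
  have p1: "?p > 1"
    using prime_card prime_gt_1_nat by blast
  have "card {y \<in> {y. y ^ P = y}. trace y = 0} = ?p ^ (m - 1)"
  proof (rule card_fibre_eq)
    show "trace ` {y. y ^ P = y} \<subseteq> range (prime_embed :: 'p mod_ring \<Rightarrow> 'q)"
      unfolding range_prime_embed using trace_power_CARD by blast
    show "0 \<in> range (prime_embed :: 'p mod_ring \<Rightarrow> 'q)"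
      unfolding range_prime_embed using p1 by (simp add: zero_power)
    have "card (range (prime_embed :: 'p mod_ring \<Rightarrow> 'q)) = ?p"
      using embed.inj_f by (simp add: card_image)
    then show "?p ^ (m - 1) * card (range (prime_embed :: 'p mod_ring \<Rightarrow> 'q)) \<le> card {y::'q. y ^ P = y}"
      unfolding card_fixed using m_pos by (simp add: P power_eq_if)
    fix u :: 'q
    let ?f = "(\<Sum>j<m. monom 1 (?p ^ j)) - [:u:]"
    \<comment> \<open>The exponents are distinct and positive, so neither another summand nor the
      constant \<open>u\<close> touches the top coefficient.\<close>
    have "coeff ?f (?p ^ (m - 1)) = (\<Sum>j<m. if j = m - 1 then 1 else 0)"
      using p1 by (simp add: coeff_sum coeff_pCons split: nat.split)
    then have "coeff ?f (?p ^ (m - 1)) = 1"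
      using m_pos by simp
    then have "?f \<noteq> 0"
      by force
    then have "card {y. poly ?f y = 0} \<le> degree ?f"
      by (rule card_poly_roots_bound)
    also have "degree ?f \<le> ?p ^ (m - 1)"
    proof (intro degree_diff_le degree_sum_le)
      fix j assume "j \<in> {..<m}"
      then have "?p ^ j \<le> ?p ^ (m - 1)"
        using p1 by (intro power_increasing) auto
      then show "degree (monom (1::'q) (?p ^ j)) \<le> ?p ^ (m - 1)"
        using degree_monom_le order_trans by blast
    qed simp_all
    also have "{y. poly ?f y = 0} = {y. trace y = u}"
      by (simp add: poly_sum poly_monom trace_def)
    finally have "card {y. trace y = u} \<le> ?p ^ (m - 1)" .
    moreover have "card {y \<in> {y. y ^ P = y}. trace y = u} \<le> card {y. trace y = u}"
      by (rule card_mono) auto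
    ultimately show "card {y \<in> {y. y ^ P = y}. trace y = u} \<le> ?p ^ (m - 1)"
      by simp
  qed simp_all
  moreover have "{y. y ^ P = y \<and> trace y \<noteq> 0} = {y. y ^ P = y} - {y \<in> {y. y ^ P = y}. trace y = 0}"
    by blast
  moreover have "card ({y. y ^ P = y} - {y \<in> {y. y ^ P = y}. trace y = 0})
      = card {y::'q. y ^ P = y} - card {y \<in> {y. y ^ P = y}. trace y = 0}"
    by (rule card_Diff_subset) auto
  ultimately show ?thesis
    unfolding P[symmetric] by (simp only: card_fixed)
qed

text \<open>Meaningful only on \<open>F\<^bsub>P\<^esub>\<close>; elsewhere \<open>trace\<close> may leave the prime field.\<close>

definition ptrace :: "'q \<Rightarrow> 'p mod_ring" where
  "ptrace y = inv_into UNIV prime_embed (trace y)"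

lemma prime_embed_ptrace:
  assumes "y ^ P = y"
  shows "prime_embed (ptrace y) = trace y"
  unfolding ptrace_def
  by (rule f_inv_into_f) (use trace_power_CARD[OF assms] range_prime_embed in simp)

section \<open>Codewords, their weights and the dual code\<close>

definition codeword :: "'q \<Rightarrow> nat \<Rightarrow> 'q \<times> 'q \<Rightarrow> 'p mod_ring vec" where
  "codeword \<theta> h v = vec (CARD('q) - 1) (\<lambda>i. ptrace (trace_form h v (\<theta> ^ i)))"

lemma codeword_carrier: "codeword \<theta> h v \<in> carrier_vec (CARD('q) - 1)"
  by (simp add: codeword_def)

lemma prime_embed_codeword:
  "i < CARD('q) - 1 \<Longrightarrow> prime_embed (codeword \<theta> h v $ i) = trace (trace_form h v (\<theta> ^ i))"
  by (simp add: codeword_def prime_embed_ptrace trace_form_fixed)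

text \<open>Exponents reduce modulo the order of the multiplicative group, so these powers already
  hit every nonzero element; equal cardinalities give injectivity.\<close>

lemma bij_betw_primitive:
  assumes "primitive_elem (\<theta>::'q)"
  shows "bij_betw (\<lambda>i. \<theta> ^ i) {..<CARD('q) - 1} (UNIV - {0})"
proof -
  have r: "range (\<lambda>k::nat. \<theta> ^ k) = UNIV - {0}"
    using assms by (simp add: primitive_elem_def)
  have N: "CARD('q) - 1 > 0"
    using card_minus_1 P_gt_1 by simp
  have "\<theta> \<noteq> 0"
    using r by (metis DiffE UNIV_I image_eqI power_one_right singletonI)
  then have one: "\<theta> ^ (CARD('q) - 1) = 1"
    using finite_field_power_card_eq_same[of \<theta>] N
    by (metis mult_cancel_left2 power_eq_if zero_less_card_finite less_not_refl2)
  have "\<theta> ^ k = \<theta> ^ (k mod (CARD('q) - 1))" for k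
  proof -
    have "\<theta> ^ k = \<theta> ^ ((CARD('q) - 1) * (k div (CARD('q) - 1)) + k mod (CARD('q) - 1))"
      by simp
    then show ?thesis
      by (simp only: power_add power_mult one power_one mult_1)
  qed
  then have "UNIV - {0} \<subseteq> (\<lambda>i. \<theta> ^ i) ` {..<CARD('q) - 1}"
    unfolding r[symmetric] using N by (metis image_iff image_subsetI lessThan_iff mod_less_divisor)
  then have img: "(\<lambda>i. \<theta> ^ i) ` {..<CARD('q) - 1} = UNIV - {0}"
    using r by blast
  moreover have "card (UNIV - {0::'q}) = CARD('q) - 1"
    by (rule card_Diff_singleton) simp
  ultimately have "inj_on (\<lambda>i. \<theta> ^ i) {..<CARD('q) - 1}"
    by (intro eq_card_imp_inj_on) simp_all
  then show ?thesis
    using img by (simp add: bij_betw_def)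
qed

lemma trace_form_diff:
  "trace_form h (fst v - fst v', snd v - snd v') x = trace_form h v x - trace_form h v' x"
  by (simp add: trace_form_def Let_def diff algebra_simps add power_mult_distrib)

text \<open>Form and trace are additive in the pair, so comparing two entries means testing an entry
  of the difference for 0.\<close>

lemma hamming_dist_codeword:
  "hamming_dist (codeword \<theta> h v) (codeword \<theta> h v')
    = hamming_weight (codeword \<theta> h (fst v - fst v', snd v - snd v'))"
proof -
  have "codeword \<theta> h v $ i \<noteq> codeword \<theta> h v' $ i \<longleftrightarrow>
      codeword \<theta> h (fst v - fst v', snd v - snd v') $ i \<noteq> 0" if "i < CARD('q) - 1" for i
    using that
    by (simp add: trace_form_diff trace_diff prime_embed_codeword
        flip: embed.eq_iff embed.hom_0_iff)
  then show ?thesis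
    by (simp add: hamming_dist_def hamming_weight_def codeword_def cong: conj_cong)
qed

lemma hamming_weight_codeword:
  assumes \<theta>: "primitive_elem \<theta>" and g: "g = gcd (2 * h + 1) (P + 1)" "g * M = P + 1"
  shows "hamming_weight (codeword \<theta> h v)
    = (P + 1 - g * card {w. w ^ M = 1 \<and> selfrec v w = 0}) * (CARD('p) ^ m - CARD('p) ^ (m - 1))"
proof -
  have nz: "codeword \<theta> h v $ i \<noteq> 0 \<longleftrightarrow> trace (trace_form h v (\<theta> ^ i)) \<noteq> 0" if "i < CARD('q) - 1" for i
    using prime_embed_codeword[OF that, of \<theta> h v] by (metis embed.hom_0_iff)
  have "hamming_weight (codeword \<theta> h v)
      = card {i \<in> {..<CARD('q) - 1}. trace (trace_form h v (\<theta> ^ i)) \<noteq> 0}"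
    unfolding hamming_weight_def using nz by (intro arg_cong[where f = card]) (auto simp: codeword_def)
  also have "bij_betw (\<lambda>i. \<theta> ^ i) {i \<in> {..<CARD('q) - 1}. trace (trace_form h v (\<theta> ^ i)) \<noteq> 0}
      {x. x \<noteq> 0 \<and> trace (trace_form h v x) \<noteq> 0}"
    using bij_betw_primitive[OF \<theta>] unfolding bij_betw_def inj_on_def by auto
  then have "card {i \<in> {..<CARD('q) - 1}. trace (trace_form h v (\<theta> ^ i)) \<noteq> 0}
      = card {x. x \<noteq> 0 \<and> trace (trace_form h v x) \<noteq> 0}"
    by (rule bij_betw_same_card)
  finally show ?thesis
    using card_trace_form[of "\<lambda>y. trace y \<noteq> 0", OF _ g] by (simp add: trace_0 card_trace_nonzero)
qed

text \<open>The entries of \<open>c\<close> lie in the prime field, so they pass through the trace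
  and commute with conjugation. The inner product becomes the trace of \<open>Y + Y ^ P\<close>,
  where \<open>Y\<close> combines the values of \<open>c\<close> at the two zeros of the code and is
  therefore 0.\<close>

lemma codeword_orthogonal:
  fixes g1 g2 :: "'p mod_ring poly"
  defines "N \<equiv> CARD('q) - 1"
  assumes \<theta>: "primitive_elem \<theta>"
    and g1: "poly (map_poly prime_embed g1) (\<theta> ^ ((h + 1) * (P - 1) + 1)) = 0"
    and g2: "poly (map_poly prime_embed g2) (\<theta> ^ ((3 * h + 2) * (P - 1) + 1)) = 0"
  shows "codeword \<theta> h v \<in> dual_code N (cyclic_code N (g1 * g2))"
proof -
  let ?x1 = "\<theta> ^ ((h + 1) * (P - 1) + 1)" and ?x2 = "\<theta> ^ ((3 * h + 2) * (P - 1) + 1)"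
  interpret E: map_poly_comm_ring_hom "prime_embed :: 'p mod_ring \<Rightarrow> 'q" ..
  have "codeword \<theta> h v \<bullet> c = 0" if c: "c \<in> cyclic_code N (g1 * g2)" for c
  proof -
    have "\<theta> ^ i \<noteq> 0" for i
      using \<theta> by (auto simp: primitive_elem_def)
    then have one: "x ^ N = 1" if "x = \<theta> ^ i" for i x
      using that finite_field_power_card_eq_same[of x] unfolding N_def
      by (metis mult_cancel_left2 power_eq_if zero_less_card_finite less_not_refl2)
    have root: "(\<Sum>i<N. prime_embed (c $ i) * x ^ i) = 0" if "x \<in> {?x1, ?x2}" for x
    proof (rule cyclic_code_root[OF card_q _ _ c])
      show "x ^ N = 1"
        using that one by blast
      show "poly (map_poly prime_embed (g1 * g2)) x = 0"
        using that g1 g2 by (auto simp: E.hom_mult)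
    qed
    have Ep: "(prime_embed (c $ i) :: 'q) ^ CARD('p) = prime_embed (c $ i)" for i
      using range_prime_embed by blast
    have EP: "(prime_embed (c $ i) :: 'q) ^ P = prime_embed (c $ i)" for i
      unfolding P by (induction m) (simp_all add: power_mult Ep)
    define y where "y i = fst v * ?x1 ^ i + snd v * ?x2 ^ i" for i
    have tf: "trace_form h v (\<theta> ^ i) = y i + y i ^ P" for i
      unfolding trace_form_def Let_def y_def by (simp only: mult.commute flip: power_mult)
    have "(\<Sum>i<N. prime_embed (c $ i) * y i)
        = fst v * (\<Sum>i<N. prime_embed (c $ i) * ?x1 ^ i) + snd v * (\<Sum>i<N. prime_embed (c $ i) * ?x2 ^ i)"
      by (simp only: y_def sum_distrib_left distrib_left sum.distrib mult_ac)
    then have Y: "(\<Sum>i<N. prime_embed (c $ i) * y i) = 0"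
      using root by simp
    have "(\<Sum>i<N. prime_embed (c $ i) * trace_form h v (\<theta> ^ i))
        = (\<Sum>i<N. prime_embed (c $ i) * y i) + (\<Sum>i<N. (prime_embed (c $ i) * y i) ^ P)"
      by (simp only: tf distrib_left sum.distrib power_mult_distrib EP)
    also have "(\<Sum>i<N. (prime_embed (c $ i) * y i) ^ P) = (\<Sum>i<N. prime_embed (c $ i) * y i) ^ P"
      by (rule freshmans_dream_sum'[OF prime_CHAR_q, symmetric]) (simp add: P CHAR_q)
    finally have "(\<Sum>i<N. prime_embed (c $ i) * trace_form h v (\<theta> ^ i)) = 0"
      using Y P_gt_1 by (simp add: zero_power)
    then have "trace (\<Sum>i<N. prime_embed (c $ i) * trace_form h v (\<theta> ^ i)) = 0"
      by (simp only: trace_0)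
    then have "(\<Sum>i<N. prime_embed (c $ i) * trace (trace_form h v (\<theta> ^ i))) = 0"
      by (simp only: trace_sum trace_scale[OF Ep])
    moreover have "prime_embed (codeword \<theta> h v \<bullet> c)
        = (\<Sum>i<N. prime_embed (c $ i) * trace (trace_form h v (\<theta> ^ i)))"
    proof -
      have "dim_vec c = N"
        using c by (auto simp: cyclic_code_def)
      then have "codeword \<theta> h v \<bullet> c = (\<Sum>i<N. c $ i * codeword \<theta> h v $ i)"
        by (simp add: scalar_prod_def atLeast0LessThan mult.commute)
      then show ?thesis
        by (simp add: embed.hom_sum embed.hom_mult prime_embed_codeword N_def)
    qed
    ultimately show ?thesis
      by simp
  qed
  then show ?thesis
    using codeword_carrier by (simp add: vec_module.orthogonal_complement_def N_def)
qed

text \<open>If two codewords agree, the difference of their pairs gives weight 0, hence a cubic with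
  at least \<open>M > 3\<close> roots, which must be zero.\<close>

lemma codeword_inj:
  assumes \<theta>: "primitive_elem (\<theta>::'q)" and g: "g = gcd (2 * h + 1) (P + 1)" "g * M = P + 1" and M: "M > 3"
  shows "inj (codeword \<theta> h)"
proof (rule injI)
  fix v v' :: "'q \<times> 'q" assume eq: "codeword \<theta> h v = codeword \<theta> h v'"
  define u where "u = (fst v - fst v', snd v - snd v')"
  have "hamming_weight (codeword \<theta> h u) = 0"
    using hamming_dist_codeword[of \<theta> h v v'] eq by (simp add: u_def hamming_dist_def)
  moreover have "CARD('p) ^ m - CARD('p) ^ (m - 1) > 0"
    using m_pos prime_card[where 'a = 'p] prime_gt_1_nat by (simp add: power_strict_increasing)
  \<comment> \<open>Weight 0 means that the truncated subtraction in the weight formula gives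
    0.\<close>
  ultimately have le: "g * M \<le> g * root_count {w. w ^ M = 1} u"
    using hamming_weight_codeword[OF \<theta> g, of u] g(2) by (simp add: root_count_def)
  have "g > 0"
    using g(1) by simp
  then have "root_count {w. w ^ M = 1} u > 3"
    using le M by simp
  then have "u = (0, 0)"
    using root_count_le_3[of u] by (metis not_le)
  then show "v = v'"
    by (simp add: u_def prod_eq_iff)
qed

lemma dual_code_eq_range_codeword:
  assumes \<theta>: "primitive_elem (\<theta>::'q)" and g: "g = gcd (2 * h + 1) (P + 1)" "g * M = P + 1" and M: "M > 3"
  defines "N \<equiv> CARD('q) - 1"
    and "g1 \<equiv> min_poly (\<theta> ^ ((h + 1) * (P - 1) + 1)) :: 'p mod_ring poly"
    and "g2 \<equiv> min_poly (\<theta> ^ ((3 * h + 2) * (P - 1) + 1)) :: 'p mod_ring poly"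
  shows "dual_code N (cyclic_code N (g1 * g2)) = range (codeword \<theta> h)" (is "?D = _")
    and "card (dual_code N (cyclic_code N (g1 * g2))) = CARD('p) ^ (4 * m)"
proof -
  have mp: "poly (map_poly prime_embed (min_poly x :: 'p mod_ring poly)) x = 0" "min_poly x \<noteq> (0 :: 'p mod_ring poly)" for x :: 'q
    using is_min_poly_min_poly[OF card_q, of x] by (auto simp: is_min_poly_def)
  have mp: "poly (map_poly prime_embed g1) (\<theta> ^ ((h + 1) * (P - 1) + 1)) = 0" "g1 \<noteq> 0"
    "poly (map_poly prime_embed g2) (\<theta> ^ ((3 * h + 2) * (P - 1) + 1)) = 0" "g2 \<noteq> 0"
    unfolding g1_def g2_def by (rule mp)+
  have sub: "range (codeword \<theta> h) \<subseteq> ?D"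
    using codeword_orthogonal[OF \<theta> mp(1,3)] by (auto simp: N_def)
  have "card (range (codeword \<theta> h)) = CARD('q \<times> 'q)"
    by (rule card_image[OF codeword_inj[OF \<theta> g M]])
  also have "\<dots> = CARD('q) * CARD('q)"
    by (simp only: card_cartesian_product flip: UNIV_Times_UNIV)
  also have "\<dots> = CARD('p) ^ (4 * m)"
    unfolding card_q by (simp flip: power_add)
  finally have r: "card (range (codeword \<theta> h)) = CARD('p) ^ (4 * m)" .
  \<comment> \<open>Each minimal polynomial has degree at most \<open>2 * m\<close>, so the upper
    bound for the dual meets the size of the range.\<close>
  have "card ?D \<le> CARD('p) ^ degree (g1 * g2)"
    using card_dual_cyclic_code_le[of "g1 * g2" N] mp by simp
  also have "degree (g1 * g2) \<le> 2 * m + 2 * m"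
    unfolding g1_def g2_def
    by (intro order_trans[OF degree_mult_le] add_mono degree_min_poly_le[OF card_q])
  then have "CARD('p) ^ degree (g1 * g2) \<le> CARD('p) ^ (4 * m)"
    by (intro power_increasing) (simp_all add: Suc_le_eq)
  finally have le: "card ?D \<le> card (range (codeword \<theta> h))"
    by (simp only: r)
  have "finite ?D"
    by (rule finite_subset[of _ "carrier_vec N"]) (auto simp: vec_module.orthogonal_complement_def)
  then show eq: "?D = range (codeword \<theta> h)"
    using card_seteq[OF _ sub le] by simp
  show "card ?D = CARD('p) ^ (4 * m)"
    unfolding eq by (rule r)
qed

text \<open>Since \<open>M > 3\<close>, the weights \<open>wt 0\<close> to \<open>wt 3\<close> are
  positive and strictly decreasing, so the weight of a nonzero codeword reveals its number of roots.
  By linearity the minimum distance is the least of them that occurs, and \<open>root\<close> says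
  that \<open>wt 3\<close> occurs.\<close>

lemma weight_distribution:
  fixes \<theta> :: 'q and D :: "'p mod_ring vec set"
  assumes \<theta>: "primitive_elem \<theta>" and g: "g = gcd (2 * h + 1) (P + 1)" "g * M = P + 1" and M: "M > 3"
  defines "N \<equiv> CARD('q) - 1"
    and "wt \<equiv> \<lambda>j. (P + 1 - g * j) * (CARD('p) ^ m - CARD('p) ^ (m - 1))"
    and "H \<equiv> {w::'q. w ^ M = 1}"
  assumes D: "D = dual_code N (cyclic_code N
      (min_poly (\<theta> ^ ((h + 1) * (P - 1) + 1)) * min_poly (\<theta> ^ ((3 * h + 2) * (P - 1) + 1))))"
    and root: "\<exists>v. v \<noteq> (0, 0) \<and> root_count H v = 3"
  shows "linear_code N (4 * m) (wt 3) D"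
    and "\<And>c. c \<in> D \<Longrightarrow> hamming_weight c \<in> {0, wt 0, wt 1, wt 2, wt 3}"
    and "card {c \<in> D. hamming_weight c = 0} = 1"
    and "\<And>j. j \<le> 3 \<Longrightarrow> card {c \<in> D. hamming_weight c = wt j} = card {v. v \<noteq> (0, 0) \<and> root_count H v = j}"
proof -
  let ?cw = "codeword \<theta> h"
  have D_eq: "D = range ?cw" and D_card: "card D = CARD('p) ^ (4 * m)"
    using dual_code_eq_range_codeword[OF \<theta> g M] by (simp_all add: D N_def)
  have "g > 0"
    using g(1) by simp
  have kpos: "CARD('p) ^ m - CARD('p) ^ (m - 1) > 0"
    using m_pos prime_card[where 'a = 'p] prime_gt_1_nat by (simp add: power_strict_increasing)
  \<comment> \<open>For at most three roots the subtraction in \<open>wt\<close> is not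
    truncated.\<close>
  have lt: "g * j < P + 1" if "j \<le> 3" for j
    unfolding g(2)[symmetric] using that M \<open>g > 0\<close> by simp
  have wt: "hamming_weight (?cw v) = wt (root_count H v)" for v
    using hamming_weight_codeword[OF \<theta> g, of v] by (simp add: wt_def root_count_def H_def)
  have wt_pos: "wt j > 0" if "j \<le> 3" for j
    using lt[OF that] kpos by (simp add: wt_def)
  have wt_inj: "wt i = wt j \<longleftrightarrow> i = j" if "i \<le> 3" "j \<le> 3" for i j
  proof -
    have "P + 1 - g * i = P + 1 - g * j \<longleftrightarrow> g * i = g * j"
      using lt[OF that(1)] lt[OF that(2)] by linarith
    then show ?thesis
      using kpos \<open>g > 0\<close> by (simp add: wt_def)
  qed
  have wt_anti: "wt 3 \<le> wt j" if "j \<le> 3" for j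
    unfolding wt_def using that by (intro mult_right_mono diff_le_mono2 mult_left_mono) auto
  have rc: "root_count H v \<le> 3" if "v \<noteq> (0, 0)" for v
    by (rule root_count_le_3[OF that])
  \<comment> \<open>The bound \<open>rc\<close> does not cover the zero pair, so its weight is
    computed directly.\<close>
  have w0: "hamming_weight (?cw (0, 0)) = 0"
  proof -
    have "trace_form h (0, 0) x = 0" for x
      using P_gt_1 by (simp add: trace_form_def zero_power)
    then have "prime_embed (?cw (0, 0) $ i) = (0::'q)" if "i < CARD('q) - 1" for i
      using that by (simp add: prime_embed_codeword trace_0)
    then show ?thesis
      by (auto simp: hamming_weight_def codeword_def)
  qed
  have count: "card {c \<in> D. Q (hamming_weight c)} = card {v. Q (hamming_weight (?cw v))}" for Q
  proof -
    have "{c \<in> D. Q (hamming_weight c)} = ?cw ` {v. Q (hamming_weight (?cw v))}"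
      by (auto simp: D_eq)
    moreover have "inj_on ?cw {v. Q (hamming_weight (?cw v))}"
      using codeword_inj[OF \<theta> g M] by (rule inj_on_subset) simp
    ultimately show ?thesis
      by (simp add: card_image)
  qed
  show "hamming_weight c \<in> {0, wt 0, wt 1, wt 2, wt 3}" if c: "c \<in> D" for c
  proof -
    obtain v where v: "c = ?cw v"
      using c D_eq by blast
    show ?thesis
    proof (cases "v = (0, 0)")
      case False
      have "root_count H v = 0 \<or> root_count H v = 1 \<or> root_count H v = 2 \<or> root_count H v = 3"
        using rc[OF False] by arith
      then show ?thesis
        unfolding v wt by auto
    qed (simp add: v w0)
  qed
  have zero_iff: "hamming_weight (?cw v) = 0 \<longleftrightarrow> v = (0, 0)" for v
    using w0 wt wt_pos[OF rc] by (metis less_irrefl)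
  show "card {c \<in> D. hamming_weight c = 0} = 1"
    using count[of "\<lambda>k. k = 0"] by (simp add: zero_iff)
  show "card {c \<in> D. hamming_weight c = wt j} = card {v. v \<noteq> (0, 0) \<and> root_count H v = j}" if j: "j \<le> 3" for j
  proof -
    have "hamming_weight (?cw v) = wt j \<longleftrightarrow> v \<noteq> (0, 0) \<and> root_count H v = j" for v
      using zero_iff[of v] wt_pos[OF j] wt[of v] wt_inj[OF rc j, of v] by auto
    then show ?thesis
      using count[of "\<lambda>k. k = wt j"] by simp
  qed
  show "linear_code N (4 * m) (wt 3) D"
    unfolding linear_code_def
  proof (intro conjI)
    have C: "cyclic_code N f \<subseteq> carrier_vec N" for f :: "'p mod_ring poly"
      by (auto simp: cyclic_code_def)
    show "subspace class_ring D (module_vec TYPE('p mod_ring) N)"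
      unfolding D by (rule subspace_dual_code[OF C])
    show "vectorspace.dim class_ring (module_vec TYPE('p mod_ring) N\<lparr>carrier := D\<rparr>) = 4 * m"
      using dim_dual_code[OF C] D_card unfolding D by simp
    show "has_min_dist D (wt 3)"
      unfolding has_min_dist_def
    proof (intro conjI ballI impI)
      obtain v where v: "v \<noteq> (0, 0)" "root_count H v = 3"
        using root by blast
      have "hamming_dist (?cw v) (?cw (0, 0)) = wt 3"
        unfolding hamming_dist_codeword using v(2) by (simp add: wt)
      moreover have "?cw v \<noteq> ?cw (0, 0)"
        using v codeword_inj[OF \<theta> g M] by (auto dest: injD)
      ultimately show "\<exists>u\<in>D. \<exists>v\<in>D. u \<noteq> v \<and> hamming_dist u v = wt 3"
        unfolding D_eq by blast
    next
      fix a b assume ab: "a \<in> D" "b \<in> D" "a \<noteq> b"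
      obtain u v where uv: "a = ?cw u" "b = ?cw v"
        using ab D_eq by blast
      have "u \<noteq> v"
        using ab(3) uv by blast
      then have "(fst u - fst v, snd u - snd v) \<noteq> (0, 0)"
        by (simp add: prod_eq_iff)
      then show "wt 3 \<le> hamming_dist a b"
        unfolding uv hamming_dist_codeword wt by (intro wt_anti rc)
    qed
  qed
qed

end

section \<open>The weight distribution\<close>

lemma choose_3_real: "6 * real (n choose 3) = real n * (real n - 1) * (real n - 2)"
proof (induction n)
  case (Suc n)
  have "real (Suc n choose 3) = real (n choose 2) + real (n choose 3)"
    by (simp add: numeral_3_eq_3 numeral_2_eq_2)
  moreover have "2 * real (n choose 2) = real n * (real n - 1)"
    by (induction n) (simp_all add: numeral_2_eq_2 algebra_simps)
  ultimately show ?case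
    using Suc.IH by (simp add: algebra_simps)
qed simp

text \<open>Back substitution from \<open>N3\<close> down to \<open>N0\<close>. Once the denominator
  \<open>L ^ 3\<close> is cleared and \<open>P\<close>, \<open>L\<close> are written in
  \<open>G\<close> and \<open>M\<close>, each formula is a polynomial identity in these two.\<close>

lemma frequencies_from_moments:
  fixes P G M N0 N1 N2 N3 :: real
  assumes PM: "P = G * M - 1" and G: "G \<noteq> 0" and L: "L = 2 * G"
    and m0: "N0 + N1 + N2 + N3 = P ^ 4 - 1"
    and m1: "N1 + 2 * N2 + 3 * N3 = M * (P ^ 3 - 1)"
    and m2: "N2 + 3 * N3 = M * (M - 1) / 2 * (P ^ 2 - 1)"
    and m3: "N3 = M * (M - 1) * (M - 2) / 6 * (P - 1)"
  shows "N3 = 2 * (P ^ 2 - 1) * (L - P - 1) * (L - 2 * P - 2) / (3 * L ^ 3)"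
    and "N2 = (P ^ 2 - 1) * (2 * P + 2 - (P + 3) * L) * (L - 2 * P - 2) / L ^ 3"
    and "N1 = 2 * (P ^ 2 - 1) *
          ((P ^ 2 + 2 * P + 3) * L ^ 2 - (2 * P ^ 2 + 7 * P + 5) * L + 2 * (P + 1) ^ 2) / L ^ 3"
    and "N0 = (P ^ 2 - 1) *
          (3 * (P ^ 2 + 1) * L ^ 3 - (6 * P ^ 2 + 9 * P + 11) * L ^ 2
            + 6 * (P ^ 2 + 3 * P + 2) * L - 4 * (P + 1) ^ 2) / (3 * L ^ 3)"
proof -
  have N2: "N2 = M * (M - 1) / 2 * (P ^ 2 - 1) - 3 * N3"
    and N1: "N1 = M * (P ^ 3 - 1) - 2 * N2 - 3 * N3"
    and N0: "N0 = P ^ 4 - 1 - N1 - N2 - N3"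
    using m0 m1 m2 by simp_all
  have L0: "L ^ 3 \<noteq> 0" "3 * L ^ 3 \<noteq> 0"
    using G L by simp_all
  note exp = PM L power2_eq_square power3_eq_cube power4_eq_xxxx
  show "N3 = 2 * (P ^ 2 - 1) * (L - P - 1) * (L - 2 * P - 2) / (3 * L ^ 3)"
    unfolding nonzero_eq_divide_eq[OF L0(2)]
    unfolding m3 exp by (simp add: field_simps)
  show "N2 = (P ^ 2 - 1) * (2 * P + 2 - (P + 3) * L) * (L - 2 * P - 2) / L ^ 3"
    unfolding nonzero_eq_divide_eq[OF L0(1)]
    unfolding N2 m3 exp by (simp add: field_simps)
  show "N1 = 2 * (P ^ 2 - 1) *
          ((P ^ 2 + 2 * P + 3) * L ^ 2 - (2 * P ^ 2 + 7 * P + 5) * L + 2 * (P + 1) ^ 2) / L ^ 3"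
    unfolding nonzero_eq_divide_eq[OF L0(1)]
    unfolding N1 N2 m3 exp by (simp add: field_simps)
  show "N0 = (P ^ 2 - 1) *
          (3 * (P ^ 2 + 1) * L ^ 3 - (6 * P ^ 2 + 9 * P + 11) * L ^ 2
            + 6 * (P ^ 2 + 3 * P + 2) * L - 4 * (P + 1) ^ 2) / (3 * L ^ 3)"
    unfolding nonzero_eq_divide_eq[OF L0(2)]
    unfolding N0 N1 N2 m3 exp by (simp add: field_simps)
qed

theorem theorem18:
  fixes \<theta> :: "'q::finite_field"
    and D :: "'p::prime_card mod_ring vec set"
    and p m n q t s1 s2 d1 d2 l :: nat
    and P L w1 w2 w3 w4 :: real
  assumes "m \<ge> 1" and "n = 2 * m"
    and "prime p" and "odd p" and "CARD('p) = p"
    and "q = p ^ n" and "CARD('q) = q"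
    and "primitive_elem \<theta>"
    and "t > 0" and "[t = 2] (mod 4)" and "\<not> [t = 0] (mod (p ^ m + 1))"
    and "s1 = (t + 2) div 4" and "s2 = (3 * t + 2) div 4"
    and "d1 = s1 * (p ^ m - 1) + 1" and "d2 = s2 * (p ^ m - 1) + 1"
    and "l = gcd t (p ^ m + 1)"
    and "D = dual_code (q - 1) (cyclic_code (q - 1) (min_poly (\<theta> ^ d1) * min_poly (\<theta> ^ d2)))"
    and "P = real p ^ m" and "L = real l"
    and "w1 = (P - real p ^ (m - 1)) * (P + 1 - 3 * L / 2)"
    and "w2 = (P - real p ^ (m - 1)) * (P + 1 - L)"
    and "w3 = (P - real p ^ (m - 1)) * (P + 1 - L / 2)"
    and "w4 = (P - real p ^ (m - 1)) * (P + 1)"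
  shows "(\<exists>d. real d = w1 \<and> linear_code (p ^ n - 1) (4 * m) d D)
    \<and> (\<forall>c\<in>D. real (hamming_weight c) \<in> {0, w1, w2, w3, w4})
    \<and> card {c \<in> D. hamming_weight c = 0} = 1
    \<and> real (card {c \<in> D. real (hamming_weight c) = w1}) =
        2 * (P ^ 2 - 1) * (L - P - 1) * (L - 2 * P - 2) / (3 * L ^ 3)
    \<and> real (card {c \<in> D. real (hamming_weight c) = w2}) =
        (P ^ 2 - 1) * (2 * P + 2 - (P + 3) * L) * (L - 2 * P - 2) / L ^ 3
    \<and> real (card {c \<in> D. real (hamming_weight c) = w3}) =
        2 * (P ^ 2 - 1) *
          ((P ^ 2 + 2 * P + 3) * L ^ 2 - (2 * P ^ 2 + 7 * P + 5) * L + 2 * (P + 1) ^ 2) / L ^ 3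
    \<and> real (card {c \<in> D. real (hamming_weight c) = w4}) =
        (P ^ 2 - 1) *
          (3 * (P ^ 2 + 1) * L ^ 3 - (6 * P ^ 2 + 9 * P + 11) * L ^ 2
            + 6 * (P ^ 2 + 3 * P + 2) * L - 4 * (P + 1) ^ 2) / (3 * L ^ 3)"
proof -
  define h where "h = t div 4"
  have t: "t = 2 * (2 * h + 1)"
    using assms(10) unfolding cong_def h_def by presburger
  have s: "s1 = h + 1" "s2 = 3 * h + 2"
    unfolding assms(12,13) t by simp_all
  have card_q: "CARD('q) = CARD('p) ^ (2 * m)"
    using assms by simp
  have CH: "CHAR('q) = CARD('p)"
    by (rule CHAR_eq_CARD[OF card_q])
  interpret trace_code "p ^ m" "TYPE('q)" "TYPE('p)" m
  proof
    show "CARD('q) = (p ^ m)\<^sup>2"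
      using assms by (simp add: mult.commute flip: power_mult)
    show "odd (p ^ m)"
      using assms by simp
    show "(x + y) ^ p ^ m = x ^ p ^ m + y ^ p ^ m" for x y :: 'q
      by (rule freshmans_dream') (use CH assms in auto)
    show "p ^ m = CARD('p) ^ m"
      using assms by simp
  qed
  define g where "g = gcd (2 * h + 1) (p ^ m + 1)"
  define M where "M = (p ^ m + 1) div g"
  have gM: "g * M = p ^ m + 1"
    by (simp add: M_def g_def)
  \<comment> \<open>Both \<open>t\<close> and \<open>P + 1\<close> are even, which yields the factor
    2; halving \<open>P + 1\<close> does not change its gcd with the odd
    \<open>2 * h + 1\<close>.\<close>
  have l: "l = 2 * g"
  proof -
    obtain r where r: "p ^ m + 1 = 2 * r"
      using odd by (metis dvdE odd_even_add odd_one)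
    have "l = 2 * gcd (2 * h + 1) r"
      unfolding assms(16) t r by (rule gcd_mult_distrib_nat[symmetric])
    moreover have "algebraic_semidom_class.coprime (2 * h + 1) 2"
      by simp
    then have "gcd (2 * h + 1) (2 * r) = gcd (2 * h + 1) r"
      by (rule gcd_mult_right_left_cancel)
    ultimately show ?thesis
      by (simp only: g_def r)
  qed
  \<comment> \<open>\<open>M\<close> is even because \<open>g\<close> is odd and
    \<open>P + 1\<close> even. The value 2 would make \<open>l\<close> equal to
    \<open>P + 1\<close>, a divisor of \<open>t\<close>, which is excluded; so \<open>M\<close> is
    at least 4.\<close>
  have "odd g"
    unfolding g_def by (metis dvd_trans even_plus_one_iff dvd_triv_left gcd_dvd1)
  moreover have "even (g * M)"
    unfolding gM using odd by simp
  ultimately have "even M"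
    by simp
  moreover have "M \<noteq> 0"
    using gM by (metis add_is_0 mult_0_right one_neq_zero)
  moreover have "M \<noteq> 2"
  proof
    assume "M = 2"
    then have "p ^ m + 1 = l"
      using gM l by simp
    then have "(p ^ m + 1) dvd t"
      unfolding assms(16) by (metis gcd_dvd1)
    then show False
      using assms(11) by (simp add: cong_0_iff)
  qed
  ultimately have M: "M > 3"
    by presburger
  define H where "H = {w::'q. w ^ M = 1}"
  have H: "H \<subseteq> {w. w ^ (p ^ m + 1) = 1}"
  proof
    fix w assume "w \<in> H"
    then have "(w ^ M) ^ g = 1"
      by (simp add: H_def)
    then show "w \<in> {w. w ^ (p ^ m + 1) = 1}"
      unfolding gM[symmetric] by (simp add: mult.commute flip: power_mult)
  qed
  have card_H: "card H = M"
    unfolding H_def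
  proof (rule card_power_eq)
    show "M * (g * (p ^ m - 1)) = CARD('q) - 1"
      unfolding card_minus_1 gM[symmetric] by simp
  qed simp
  define F where "F j = card {v. v \<noteq> (0, 0) \<and> root_count H v = j}" for j
  note moments = root_count_moments[OF H, folded F_def, unfolded card_H]
  \<comment> \<open>The third moment shows that cubics with three roots in \<open>H\<close> exist,
    so the claimed minimum distance is attained.\<close>
  have "F 3 > 0"
    unfolding moments(4) using M P_gt_1 by (simp add: zero_less_binomial)
  then have "{v. v \<noteq> (0, 0) \<and> root_count H v = 3} \<noteq> {}"
    unfolding F_def by (metis card.empty less_irrefl)
  then have root: "\<exists>v. v \<noteq> (0, 0) \<and> root_count H v = 3"
    by blast
  define wt where "wt j = (p ^ m + 1 - g * j) * (CARD('p) ^ m - CARD('p) ^ (m - 1))" for j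
  have N: "q - 1 = CARD('q) - 1" "p ^ n - 1 = CARD('q) - 1"
    using assms by simp_all
  have D: "D = dual_code (CARD('q) - 1) (cyclic_code (CARD('q) - 1)
      (min_poly (\<theta> ^ ((h + 1) * (p ^ m - 1) + 1)) * min_poly (\<theta> ^ ((3 * h + 2) * (p ^ m - 1) + 1))))"
    unfolding assms(17) assms(14,15) s N(1) ..
  note wd = weight_distribution[OF assms(8) g_def gM M D root[unfolded H_def], folded H_def, folded wt_def, folded F_def]
  have P1: "p ^ (m - 1) \<le> p ^ m" "p ^ m > 1"
    using P_gt_1 prime_ge_1_nat[OF assms(3)] by (simp_all add: power_increasing)
  have rP: "P = real g * real M - 1"
    using arg_cong[OF gM, of real] assms(18) by simp
  have rw: "real (wt j) = (P - real p ^ (m - 1)) * (P + 1 - real g * real j)" if "j \<le> 3" for j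
  proof -
    have "g * j \<le> p ^ m + 1"
      unfolding gM[symmetric] using that M by (intro mult_left_mono) auto
    then have "real (p ^ m + 1 - g * j) = P + 1 - real g * real j"
      using assms(18) by (simp add: of_nat_diff)
    moreover have "real (p ^ m - p ^ (m - 1)) = P - real p ^ (m - 1)"
      using P1 assms(18) by (simp add: of_nat_diff)
    ultimately show ?thesis
      using assms(5) by (simp add: wt_def)
  qed
  have L: "L = 2 * real g"
    using assms(19) l by simp
  \<comment> \<open>Each root lowers the second factor of the weight by \<open>g = L / 2\<close>, so
    \<open>w1\<close>, \<open>w2\<close>, \<open>w3\<close>, \<open>w4\<close> belong to 3, 2, 1, 0
    roots.\<close>
  have w: "w1 = real (wt 3)" "w2 = real (wt 2)" "w3 = real (wt 1)" "w4 = real (wt 0)"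
    using assms(20-23) L by (simp_all add: rw)
  have freq: "real (card {c \<in> D. real (hamming_weight c) = real (wt j)}) = real (F j)" if "j \<le> 3" for j
    using wd(4)[OF that] by simp
  have g0: "real g \<noteq> 0"
    by (simp add: g_def)
  have m0: "real (F 0) + real (F 1) + real (F 2) + real (F 3) = P ^ 4 - 1"
    using arg_cong[OF moments(1), of real] P1(2) assms(18) by (simp add: of_nat_diff)
  have m1: "real (F 1) + 2 * real (F 2) + 3 * real (F 3) = real M * (P ^ 3 - 1)"
    using arg_cong[OF moments(2), of real] P1(2) assms(18) by (simp add: of_nat_diff)
  have c2: "real (M choose 2) = real M * (real M - 1) / 2"
    using M by (simp add: choose_two real_of_nat_div of_nat_diff)
  have m2: "real (F 2) + 3 * real (F 3) = real M * (real M - 1) / 2 * (P ^ 2 - 1)"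
    using arg_cong[OF moments(3), of real] P1(2) assms(18) by (simp add: of_nat_diff c2)
  have m3: "real (F 3) = real M * (real M - 1) * (real M - 2) / 6 * (P - 1)"
    using arg_cong[OF moments(4), of real] P1(2) assms(18) choose_3_real[of M] by (simp add: of_nat_diff)
  note fr = frequencies_from_moments[OF rP g0 L m0 m1 m2 m3]
  show ?thesis
    unfolding w freq[OF order_refl] N(2)
  proof (intro conjI)
    show "\<exists>d. real d = real (wt 3) \<and> linear_code (CARD('q) - 1) (4 * m) d D"
      using wd(1) by blast
    show "\<forall>c\<in>D. real (hamming_weight c) \<in> {0, real (wt 3), real (wt 2), real (wt 1), real (wt 0)}"
      using wd(2) by fastforce
    show "card {c \<in> D. hamming_weight c = 0} = 1"
      by (rule wd(3))
  qed (simp_all only: freq fr order_refl le_numeral_extra)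
qed

end
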